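(* Let $P_1,\dots,P_n$ be p-values and let $\boldsymbol\omega=(\omega_1,\dots,\omega_n)$ be non-random weights with $\omega_i>0$ and $\sum_{i=1}^n\omega_i=n$. Assume that under the global null $H_0^{\mathrm{global}}$ the joint distribution of $(1-P_1,\dots,1-P_n)$ is an MRV copula (in particular all its marginals are standard uniform). For $\gamma>0$ and $F\in\mathscr{R}^*_{-\gamma}$ consider the limiting scaled type-I error $$q(\gamma)=\lim_{\alpha\downarrow 0}\frac{\mathbb{P}_{H_0^{\mathrm{global}}}\left(P_{\mathrm{comb}}^{F,\boldsymbol\omega}\le\alpha\right)}{\alpha}.$$ Then $q(\gamma)$ depends on the transformation function $F$ only through its tail index $\gamma$, and it is non-decreasing in $\gamma$, that is, $q(\gamma_1)\ge q(\gamma_2)$ for all $\gamma_1>\gamma_2>0$. Moreover, equality holds if and only if $(1-P_1,\dots,1-P_n)$ is asymptotically independent. In particular, $q(1)=1$, and hence the test is asymptotically valid for all $\gamma\le1$, i.e. $q(\gamma)\le 1$ for all $0<\gamma\le 1$.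
   Context: The number $n$ of p-values is fixed; $H_0^{\mathrm{global}}$ is the global null hypothesis (all $n$ base null hypotheses are true) and $\mathbb{P}_{H_0^{\mathrm{global}}}$ is probability under it. For a CDF $F$, $\overline F=1-F$ and $Q_F(t)=\inf\{x\in\mathbb{R}:F(x)\ge t\}$ for $t\in(0,1)$; when the support of $F$ is $[c,\infty)$ set $Q_F(0)=c$. For $\gamma>0$, $\mathscr{R}_{-\gamma}$ is the class of CDFs $F$ with $\lim_{x\to\infty}\overline F(xy)/\overline F(x)=y^{-\gamma}$ for all $y>0$. $\mathscr{R}^*_{-\gamma}$ is the class of $F\in\mathscr{R}_{-\gamma}$ that are continuous and strictly increasing on their support, with support $[c,\infty)$ for some $c\in\mathbb{R}$. Weighted heavy-tailed combination test: for $F\in\mathscr{R}^*_{-\gamma}$, with $x^+=\max(0,x)$, $$\bar X_{n,\boldsymbol\omega}=\frac1n\sum_{i=1}^n Q_F\left((1-P_i/\omega_i)^+\right),\qquad P_{\mathrm{comb}}^{F,\boldsymbol\omega}=\min\left(1,\,n^{1-\gamma}\,\overline F(\bar X_{n,\boldsymbol\omega})\right).$$ MRV copula: for an $n$-dimensional copula $C$ let $D(u_1,\dots,u_n)=1-C(1-u_1,\dots,1-u_n)$, $u\in[0,1]^n$. $C$ is an MRV copula if for some (real-valued) function $\ell$, $\lim_{s\downarrow0}s^{-1}D(sv_1,\dots,sv_n)=\ell(v_1,\dots,v_n)$ for all $v_1,\dots,v_n\ge0$. Equivalently, there is a copula $C^*$ (the limiting copula) with $\lim_{t\to\infty}C(u_1^{1/t},\dots,u_n^{1/t})^t=C^*(u_1,\dots,u_n)$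 for all $u\in[0,1]^n$. A random vector with continuous marginals is asymptotically independent if its copula is MRV with limiting copula $C^*(u_1,\dots,u_n)=u_1\cdots u_n$ (equivalently $\ell(v_1,\dots,v_n)=v_1+\dots+v_n$). *)

theory Defs
  imports "HOL-Probability.Probability"
begin

text \<open>Coordinates are indexed by a finite type \<open>'n\<close>, so the number of p-values is
  \<open>n = CARD('n)\<close>, and points of \<open>\<real>\<^sup>n\<close> are functions \<open>'n \<Rightarrow> real\<close>.\<close>

subsection \<open>Heavy-tailed distribution functions\<close>

definition is_cdf :: "(real \<Rightarrow> real) \<Rightarrow> bool" where
  "is_cdf F \<longleftrightarrow> (\<exists>N. real_distribution N \<and> F = cdf N)"

text \<open>The topological support of the distribution with distribution function \<open>F\<close>.\<close>

definition cdf_support :: "(real \<Rightarrow> real) \<Rightarrow> real set" where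
  "cdf_support F = {x. \<forall>e>0. F (x - e) < F (x + e)}"

text \<open>The value at \<open>0\<close> is the left end point of the support. Arguments \<open>t \<ge> 1\<close> are
  irrelevant: below they are only reached when some p-value is \<open>\<le> 0\<close>, a null event.\<close>

definition quantile :: "(real \<Rightarrow> real) \<Rightarrow> real \<Rightarrow> real" where
  "quantile F t = (if t = 0 then Inf (cdf_support F) else Inf {x. F x \<ge> t})"

lemma quantile_zero: "cdf_support F = {c..} \<Longrightarrow> quantile F 0 = c"
  by (simp add: quantile_def)

definition RV :: "real \<Rightarrow> (real \<Rightarrow> real) set" where
  "RV \<gamma> = {F. is_cdf F \<and>
     (\<forall>y>0. ((\<lambda>x. (1 - F (x * y)) / (1 - F x)) \<longlongrightarrow> y powr (- \<gamma>)) at_top)}"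

text \<open>Continuity is only required on the support \<open>[c, \<infinity>)\<close>; an atom at \<open>c\<close> is not excluded.\<close>

definition RV_star :: "real \<Rightarrow> (real \<Rightarrow> real) set" where
  "RV_star \<gamma> = {F \<in> RV \<gamma>.
     continuous_on (cdf_support F) F \<and>
     strict_mono_on (cdf_support F) F \<and>
     (\<exists>c. cdf_support F = {c..})}"

subsection \<open>The weighted combination test\<close>

definition comb_stat ::
  "(real \<Rightarrow> real) \<Rightarrow> ('n::finite \<Rightarrow> real) \<Rightarrow> ('n \<Rightarrow> real) \<Rightarrow> real" where
  "comb_stat F w p = (\<Sum>i\<in>UNIV. quantile F (max 0 (1 - p i / w i))) / real CARD('n)"

definition comb_pvalue ::
  "real \<Rightarrow> (real \<Rightarrow> real) \<Rightarrow> ('n::finite \<Rightarrow> real) \<Rightarrow> ('n \<Rightarrow> real) \<Rightarrow> real" where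
  "comb_pvalue \<gamma> F w p =
     min 1 (real CARD('n) powr (1 - \<gamma>) * (1 - F (comb_stat F w p)))"

subsection \<open>Copulas\<close>

definition unit_cube :: "('n::finite \<Rightarrow> real) set" where
  "unit_cube = {u. \<forall>i. 0 \<le> u i \<and> u i \<le> 1}"

definition joint_cdf :: "'a measure \<Rightarrow> ('n::finite \<Rightarrow> 'a \<Rightarrow> real) \<Rightarrow> ('n \<Rightarrow> real) \<Rightarrow> real" where
  "joint_cdf M X u = measure M {x \<in> space M. \<forall>i. X i x \<le> u i}"

text \<open>A copula is a function on the unit cube; its values elsewhere are left unconstrained.\<close>

definition is_copula :: "(('n::finite \<Rightarrow> real) \<Rightarrow> real) \<Rightarrow> bool" where
  "is_copula C \<longleftrightarrow>
     (\<exists>N :: ('n \<Rightarrow> real) measure.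
        prob_space N \<and> sets N = sets (\<Pi>\<^sub>M i\<in>UNIV. borel) \<and>
        (\<forall>i. distr N borel (\<lambda>x. x i) = uniform_measure lborel {0..1}) \<and>
        (\<forall>u\<in>unit_cube. C u = joint_cdf N (\<lambda>i x. x i) u))"

definition copula_tail :: "(('n::finite \<Rightarrow> real) \<Rightarrow> real) \<Rightarrow> ('n \<Rightarrow> real) \<Rightarrow> real" where
  "copula_tail C u = 1 - C (\<lambda>i. 1 - u i)"

definition mrv_copula :: "(('n::finite \<Rightarrow> real) \<Rightarrow> real) \<Rightarrow> bool" where
  "mrv_copula C \<longleftrightarrow> is_copula C \<and>
     (\<exists>l :: ('n \<Rightarrow> real) \<Rightarrow> real. \<forall>v. (\<forall>i. 0 \<le> v i) \<longrightarrow>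
        ((\<lambda>s. copula_tail C (\<lambda>i. s * v i) / s) \<longlongrightarrow> l v) (at_right 0))"

definition limiting_copula ::
  "(('n::finite \<Rightarrow> real) \<Rightarrow> real) \<Rightarrow> (('n \<Rightarrow> real) \<Rightarrow> real) \<Rightarrow> bool" where
  "limiting_copula C C' \<longleftrightarrow> is_copula C' \<and>
     (\<forall>u\<in>unit_cube. ((\<lambda>t. C (\<lambda>i. u i powr (1 / t)) powr t) \<longlongrightarrow> C' u) at_top)"

text \<open>The copula of a random vector, via Sklar's theorem; it is unique on the unit cube when
  the marginals are continuous.\<close>

definition copula_of ::
  "'a measure \<Rightarrow> ('n::finite \<Rightarrow> 'a \<Rightarrow> real) \<Rightarrow> (('n \<Rightarrow> real) \<Rightarrow> real) \<Rightarrow> bool" where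
  "copula_of M X C \<longleftrightarrow> is_copula C \<and>
     (\<forall>x. joint_cdf M X x = C (\<lambda>i. cdf (distr M borel (X i)) (x i)))"

definition asymptotically_independent ::
  "'a measure \<Rightarrow> ('n::finite \<Rightarrow> 'a \<Rightarrow> real) \<Rightarrow> bool" where
  "asymptotically_independent M X \<longleftrightarrow>
     (\<forall>i. X i \<in> borel_measurable M \<and> continuous_on UNIV (cdf (distr M borel (X i)))) \<and>
     (\<exists>C. copula_of M X C \<and> mrv_copula C \<and> limiting_copula C (\<lambda>u. \<Prod>i\<in>UNIV. u i))"

end

theory Submission
  imports Defs "HOL-Real_Asymp.Real_Asymp"
begin

text \<open>
  The inverse p-values \<open>Y i = w i / P i\<close> have tails \<open>Pr(Y i > z) = w i / z\<close>, and the MRV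
  condition says that \<open>z * Pr(Y i > z * y i for some i)\<close> converges as \<open>z\<close> tends to infinity. If \<open>F\<close> is
  regularly varying with index \<open>\<gamma>\<close>, then at extreme levels the \<open>i\<close>-th transformed p-value behaves like
  \<open>Y i powr (1 / \<gamma>)\<close>. The test thus rejects, in the limit, when the \<open>p\<close>-norm of \<open>Y\<close> with \<open>p = 1 / \<gamma>\<close>
  exceeds \<open>n / \<alpha>\<close>, and \<open>n * q \<gamma>\<close> is the constant \<open>k\<close> in the tail \<open>Pr(pnorm p Y > z) \<sim> k / z\<close>.

  Existence of the limit, and its dependence on \<open>F\<close> through \<open>\<gamma>\<close> alone, are shown without constructing
  a limit measure. By inclusion-exclusion the rescaled probabilities of all boxes away from the
  origin converge to values that depend only on \<open>\<gamma>\<close> and the MRV limit \<open>l\<close> (\<open>cell_limit\<close>). Hence two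
  families of vectors with the same tail function have nearly the same threshold probabilities for
  their sums at nearby levels (\<open>tail_function_compare\<close>). Comparing the Pareto family with itself, where
  a change of level is a change of scale, gives existence of the limit (\<open>pareto_limit_exists\<close>), and
  comparing it with the family of a general \<open>F\<close> identifies the limits (\<open>comb_pvalue_limit\<close>).

  The properties of \<open>q\<close> rest on the fact that the tail constant \<open>k\<close> behaves like an integral. If
  \<open>Pr(Z > z) \<sim> k / z\<close>, then the truncated mean of \<open>Z\<close> at level \<open>N\<close> is asymptotic to \<open>k * ln N\<close>, which is
  insensitive to changing the truncation level by a constant factor. So an inequality between finite
  sums of nonnegative variables carries over to their tail constants (\<open>tail_const_sum_mono\<close>). For the
  sum of the \<open>Y i\<close> this gives \<open>n * q 1 = n\<close>, and the monotonicity of \<open>q\<close> is the monotonicity of the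
  \<open>p\<close>-norm in \<open>p\<close>.

  For the case of equality, two different \<open>p\<close>-norms of a nonnegative vector agree only if at most one
  coordinate is nonzero, in which case every weighted sum of the coordinates is the weighted maximum.
  By compactness of the simplex this becomes an inequality between homogeneous functions, and
  passing to tail constants turns it into \<open>l v = (\<Sum>i. v i)\<close>, because the tail constant of a weighted
  maximum of the \<open>Y i\<close> is a value of \<open>l\<close>. Conversely, this identity makes the tail constants of all
  \<open>p\<close>-norms equal to that of the maximum. Finally the limiting copula of \<open>1 - P\<close> is
  \<open>exp (- l (- ln u))\<close>, which is the product of the \<open>u i\<close> exactly if \<open>l\<close> is the coordinate sum.
\<close>

section \<open>Sums of families with a common tail function\<close>

context prob_space
begin

text \<open>A family \<open>T\<^sub>t\<close> of random vectors indexed by \<open>t \<down> 0\<close> has tail function \<open>L\<close> if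
  the probability that some coordinate of \<open>T\<^sub>t\<close> exceeds that of \<open>y\<close>, divided by \<open>t\<close>, tends
  to \<open>L y\<close> for every \<open>y\<close> with positive coordinates. The coordinates may be
  negative, but only by an amount that is uniformly negligible in the limit. Measurability is
  required for all \<open>t\<close>, also for the irrelevant \<open>t \<le> 0\<close>.\<close>

definition tail_function :: "(real \<Rightarrow> 'n::finite \<Rightarrow> 'a \<Rightarrow> real) \<Rightarrow> (('n \<Rightarrow> real) \<Rightarrow> real) \<Rightarrow> bool" where
  "tail_function T L \<longleftrightarrow>
     (\<forall>t i. T t i \<in> borel_measurable M) \<and>
     (\<forall>e>0. \<forall>\<^sub>F t in at_right 0. \<forall>x\<in>space M. \<forall>i. - e \<le> T t i x) \<and>
     (\<forall>y. (\<forall>i. 0 < y i) \<longrightarrow>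
        ((\<lambda>t. prob {x \<in> space M. \<exists>i. y i < T t i x} / t) \<longlongrightarrow> L y) (at_right 0))"

text \<open>The event that \<open>X\<close> lies below \<open>y\<close> in all coordinates and above \<open>a\<close> in those belonging to \<open>A\<close>.\<close>

definition cell :: "('n::finite \<Rightarrow> 'a \<Rightarrow> real) \<Rightarrow> 'n set \<Rightarrow> ('n \<Rightarrow> real) \<Rightarrow> ('n \<Rightarrow> real) \<Rightarrow> 'a set" where
  "cell X A a y = {x \<in> space M. \<forall>i. X i x \<le> y i \<and> (i \<in> A \<longrightarrow> a i < X i x)}"

lemma cell_measurable:
  assumes [measurable]: "\<And>i. X i \<in> borel_measurable M"
  shows "cell X A a y \<in> sets M"
  unfolding cell_def by measurable

text \<open>Inclusion-exclusion, one coordinate at a time. Without lower bounds the cell has probability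
  tending to 1, so its deviation from 1 is rescaled instead. The limit \<open>b\<close> is
  chosen before the family \<open>T\<close>: it depends on \<open>L\<close> only.\<close>

lemma cell_limit_aux:
  fixes L :: "('n::finite \<Rightarrow> real) \<Rightarrow> real"
  assumes "finite A" "\<And>i. 0 < y i" "\<And>i. i \<in> A \<Longrightarrow> 0 < a i \<and> a i \<le> y i"
  shows "\<exists>b. \<forall>T. tail_function T L \<longrightarrow>
    ((\<lambda>t. (prob (cell (T t) A a y) - of_bool (A = {})) / t) \<longlongrightarrow> b) (at_right 0)"
  using assms
proof (induction A arbitrary: y rule: finite_induct)
  case empty
  have "((\<lambda>t. (prob (cell (T t) {} a y) - of_bool ({} = {})) / t) \<longlongrightarrow> - L y) (at_right 0)"
    if T: "tail_function T L" for T
  proof -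
    have [measurable]: "T t i \<in> borel_measurable M" for t i
      using T by (auto simp: tail_function_def)
    have "prob {x \<in> space M. \<exists>i. y i < T t i x} = 1 - prob (cell (T t) {} a y)" for t
    proof -
      have "{x \<in> space M. \<exists>i. y i < T t i x} = space M - cell (T t) {} a y"
        by (auto simp: cell_def) (meson not_le)+
      then show ?thesis
        by (simp add: prob_compl cell_measurable)
    qed
    moreover have "((\<lambda>t. prob {x \<in> space M. \<exists>i. y i < T t i x} / t) \<longlongrightarrow> L y) (at_right 0)"
      using T empty by (auto simp: tail_function_def)
    ultimately have "((\<lambda>t. (1 - prob (cell (T t) {} a y)) / t) \<longlongrightarrow> L y) (at_right 0)"
      by simp
    from tendsto_minus[OF this] show ?thesis
      by (simp add: minus_divide_left)
  qed
  then show ?case by blast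
next
  case (insert j A)
  define y' where "y' = y(j := a j)"
  have y': "0 < y' i" for i using insert.prems by (auto simp: y'_def)
  have ay': "0 < a i \<and> a i \<le> y' i" if "i \<in> A" for i
    using insert.prems(2)[of i] insert.hyps that by (auto simp: y'_def)
  obtain b1 where b1: "\<And>T. tail_function T L \<Longrightarrow>
     ((\<lambda>t. (prob (cell (T t) A a y) - of_bool (A = {})) / t) \<longlongrightarrow> b1) (at_right 0)"
    using insert.IH[of y] insert.prems by auto
  obtain b2 where b2: "\<And>T. tail_function T L \<Longrightarrow>
     ((\<lambda>t. (prob (cell (T t) A a y') - of_bool (A = {})) / t) \<longlongrightarrow> b2) (at_right 0)"
    using insert.IH[OF y' ay'] by auto
  have "((\<lambda>t. (prob (cell (T t) (insert j A) a y) - of_bool (insert j A = {})) / t)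
          \<longlongrightarrow> b1 - b2) (at_right 0)" if T: "tail_function T L" for T
  proof -
    have m: "T t i \<in> borel_measurable M" for t i
      using T by (auto simp: tail_function_def)
    have eq: "cell (T t) (insert j A) a y = cell (T t) A a y - cell (T t) A a y'" for t
    proof (rule set_eqI)
      fix x
      have "a j \<le> y j" using insert.prems(2)[of j] by simp
      then have y'le: "(\<forall>i. T t i x \<le> y' i) \<longleftrightarrow> (\<forall>i. T t i x \<le> y i) \<and> T t j x \<le> a j"
        unfolding y'_def fun_upd_apply by (auto intro: order_trans split: if_splits)
      show "x \<in> cell (T t) (insert j A) a y \<longleftrightarrow> x \<in> cell (T t) A a y - cell (T t) A a y'"
        unfolding cell_def mem_Collect_eq Diff_iff insert_iff
        using y'le not_le[of "T t j x" "a j"] by blast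
    qed
    have sub: "cell (T t) A a y' \<subseteq> cell (T t) A a y" for t
    proof
      fix x assume x: "x \<in> cell (T t) A a y'"
      have "y' i \<le> y i" for i using insert.prems(2)[of j] by (simp add: y'_def)
      with x show "x \<in> cell (T t) A a y" unfolding cell_def by (blast intro: order_trans)
    qed
    have "prob (cell (T t) (insert j A) a y)
       = prob (cell (T t) A a y) - prob (cell (T t) A a y')" for t
      unfolding eq by (rule finite_measure_Diff) (use m sub in \<open>auto intro: cell_measurable\<close>)
    with tendsto_diff[OF b1[OF T] b2[OF T]] show ?thesis
      by (simp add: diff_divide_distrib)
  qed
  then show ?case by blast
qed

lemma cell_limit:
  fixes L :: "('n::finite \<Rightarrow> real) \<Rightarrow> real"
  assumes "A \<noteq> {}" "\<And>i. 0 < y i" "\<And>i. i \<in> A \<Longrightarrow> 0 < a i \<and> a i \<le> y i"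
  shows "\<exists>b. \<forall>T. tail_function T L \<longrightarrow> ((\<lambda>t. prob (cell (T t) A a y) / t) \<longlongrightarrow> b) (at_right 0)"
  using cell_limit_aux[of A y a L] assms by auto

text \<open>The cell of the grid of mesh \<open>d\<close> in which coordinate \<open>i\<close> lies between \<open>d * J i\<close> and
  \<open>d * (J i + 1)\<close>; index 0 imposes no lower bound.\<close>

definition grid_cell :: "('n::finite \<Rightarrow> 'a \<Rightarrow> real) \<Rightarrow> real \<Rightarrow> ('n \<Rightarrow> nat) \<Rightarrow> 'a set" where
  "grid_cell X d J = cell X {i. J i \<noteq> 0} (\<lambda>i. d * real (J i)) (\<lambda>i. d * (real (J i) + 1))"

text \<open>The union of the cells, with all indices below \<open>K\<close>, whose lower corner has coordinate sum at
  least \<open>h\<close>.\<close>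

definition grid_event :: "('n::finite \<Rightarrow> 'a \<Rightarrow> real) \<Rightarrow> real \<Rightarrow> nat \<Rightarrow> real \<Rightarrow> 'a set" where
  "grid_event X d K h = (\<Union>J\<in>{J. (\<forall>i. J i < K) \<and> h \<le> d * (\<Sum>i\<in>UNIV. real (J i))}. grid_cell X d J)"

lemma finite_bounded_indices: "finite {J :: 'n::finite \<Rightarrow> nat. (\<forall>i. J i < K) \<and> Q J}"
proof (rule finite_subset)
  show "{J :: 'n \<Rightarrow> nat. (\<forall>i. J i < K) \<and> Q J} \<subseteq> PiE UNIV (\<lambda>_. {..<K})" by auto
  show "finite (PiE (UNIV :: 'n set) (\<lambda>_. {..<K}))" by (intro finite_PiE) auto
qed

lemma grid_cell_disjoint:
  assumes d: "0 < d" and x: "x \<in> grid_cell X d J" "x \<in> grid_cell X d J'"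
  shows "J = J'"
proof
  have *: "J i \<le> J' i" if "x \<in> grid_cell X d J" "x \<in> grid_cell X d J'" for i J J'
  proof (rule ccontr)
    assume "\<not> J i \<le> J' i"
    then have "J i \<noteq> 0" and le: "real (J' i) + 1 \<le> real (J i)" by auto
    then have "d * real (J i) < X i x" "X i x \<le> d * (real (J' i) + 1)"
      using that by (auto simp: grid_cell_def cell_def)
    moreover have "d * (real (J' i) + 1) \<le> d * real (J i)"
      using le d by simp
    ultimately show False by simp
  qed
  show "J i = J' i" for i
    using *[OF x] *[OF x(2) x(1)] by (simp add: le_antisym)
qed

lemma grid_cell_measurable:
  "(\<And>i. X i \<in> borel_measurable M) \<Longrightarrow> grid_cell X d J \<in> sets M"
  unfolding grid_cell_def by (rule cell_measurable)

lemma grid_event_measurable: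
  "(\<And>i. X i \<in> borel_measurable M) \<Longrightarrow> grid_event X d K h \<in> sets M"
  unfolding grid_event_def
  by (intro sets.finite_UN finite_bounded_indices grid_cell_measurable)

lemma grid_event_limit:
  fixes L :: "('n::finite \<Rightarrow> real) \<Rightarrow> real"
  assumes d: "0 < d" and h: "0 < h"
  shows "\<exists>b. \<forall>T. tail_function T L \<longrightarrow>
    ((\<lambda>t. prob (grid_event (T t) d K h) / t) \<longlongrightarrow> b) (at_right 0)"
proof -
  let ?I = "{J :: 'n \<Rightarrow> nat. (\<forall>i. J i < K) \<and> h \<le> d * (\<Sum>i\<in>UNIV. real (J i))}"
  have "\<exists>b. \<forall>T. tail_function T L \<longrightarrow> ((\<lambda>t. prob (grid_cell (T t) d J) / t) \<longlongrightarrow> b) (at_right 0)"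
    if J: "J \<in> ?I" for J
    unfolding grid_cell_def
  proof (rule cell_limit)
    show "{i. J i \<noteq> 0} \<noteq> {}"
    proof
      assume "{i. J i \<noteq> 0} = {}"
      then have "(\<Sum>i\<in>UNIV. real (J i)) = 0" by auto
      with J h show False by simp
    qed
  qed (use d in auto)
  then have "\<forall>J\<in>?I. \<exists>b. \<forall>T. tail_function T L \<longrightarrow> ((\<lambda>t. prob (grid_cell (T t) d J) / t) \<longlongrightarrow> b) (at_right 0)"
    by blast
  from bchoice[OF this] obtain b where b: "\<And>J T. J \<in> ?I \<Longrightarrow> tail_function T L \<Longrightarrow>
      ((\<lambda>t. prob (grid_cell (T t) d J) / t) \<longlongrightarrow> b J) (at_right 0)"
    by blast
  have "((\<lambda>t. prob (grid_event (T t) d K h) / t) \<longlongrightarrow> (\<Sum>J\<in>?I. b J)) (at_right 0)"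
    if T: "tail_function T L" for T
  proof -
    have "prob (grid_event (T t) d K h) = (\<Sum>J\<in>?I. prob (grid_cell (T t) d J))" for t
      unfolding grid_event_def
    proof (rule finite_measure_finite_Union)
      show "disjoint_family_on (grid_cell (T t) d) ?I"
        using grid_cell_disjoint[OF d] unfolding disjoint_family_on_def by blast
      show "grid_cell (T t) d ` ?I \<subseteq> sets M"
        using T by (auto simp: tail_function_def intro!: grid_cell_measurable)
    qed (rule finite_bounded_indices)
    moreover have "((\<lambda>t. \<Sum>J\<in>?I. prob (grid_cell (T t) d J) / t) \<longlongrightarrow> (\<Sum>J\<in>?I. b J)) (at_right 0)"
      by (intro tendsto_sum b T)
    ultimately show ?thesis by (simp add: sum_divide_distrib)
  qed
  then show ?thesis by blast
qed

lemma grid_event_upper: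
  fixes X :: "'n::finite \<Rightarrow> 'a \<Rightarrow> real"
  assumes d: "0 < d" and x: "x \<in> space M" "h + d * real CARD('n) \<le> (\<Sum>i\<in>UNIV. X i x)"
    and le: "\<And>i. X i x \<le> d * real K" and K: "0 < K"
  shows "x \<in> grid_event X d K h"
proof -
  define J where "J i = nat (\<lceil>X i x / d\<rceil> - 1)" for i
  have J: "X i x \<le> d * (real (J i) + 1) \<and> (J i \<noteq> 0 \<longrightarrow> d * real (J i) < X i x) \<and> J i < K" for i
  proof -
    have 1: "X i x / d \<le> real (J i) + 1" unfolding J_def by linarith
    have 2: "real (J i) < X i x / d" if "J i \<noteq> 0" using that unfolding J_def by linarith
    have "X i x / d \<le> real K" using le[of i] d by (simp add: field_simps)
    then have "\<lceil>X i x / d\<rceil> \<le> int K" by linarith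
    then have "J i < K" using K unfolding J_def by linarith
    with 1 2 d show ?thesis by (auto simp: field_simps)
  qed
  have "(\<Sum>i\<in>UNIV. X i x) \<le> (\<Sum>i\<in>UNIV. d * (real (J i) + 1))"
    using J by (intro sum_mono) auto
  also have "\<dots> = d * (\<Sum>i\<in>UNIV. real (J i)) + d * real CARD('n)"
    by (simp add: sum_distrib_left sum.distrib algebra_simps)
  finally have "h \<le> d * (\<Sum>i\<in>UNIV. real (J i))" using x(2) by simp
  moreover have "x \<in> grid_cell X d J"
    using J x by (auto simp: grid_cell_def cell_def)
  ultimately show ?thesis
    using J unfolding grid_event_def by auto
qed

lemma grid_event_lower:
  fixes X :: "'n::finite \<Rightarrow> 'a \<Rightarrow> real"
  assumes d: "0 < d" and x: "x \<in> grid_event X d K h" and ge: "\<And>i. - d \<le> X i x"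
  shows "h - d * real CARD('n) \<le> (\<Sum>i\<in>UNIV. X i x)"
proof -
  obtain J where J: "h \<le> d * (\<Sum>i\<in>UNIV. real (J i))" "x \<in> grid_cell X d J"
    using x by (auto simp: grid_event_def)
  have "d * real (J i) - d \<le> X i x" for i
  proof (cases "J i = 0")
    case True
    with ge[of i] show ?thesis by simp
  next
    case False
    with J(2) have "d * real (J i) < X i x" by (auto simp: grid_cell_def cell_def)
    with d show ?thesis by linarith
  qed
  then have "(\<Sum>i\<in>UNIV. d * real (J i) - d) \<le> (\<Sum>i\<in>UNIV. X i x)"
    by (intro sum_mono)
  with J(1) show ?thesis by (simp add: sum_subtractf sum_distrib_left mult.commute)
qed

text \<open>Two families with the same tail function are compared through a fine grid: the threshold
  probabilities of their sums differ little as soon as the levels \<open>h2 < h1\<close> are separated. The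
  bound \<open>B\<close> is, up to \<open>e / 2\<close>, the limit of the rescaled probability of a grid event, which is the
  same for both families.\<close>

lemma tail_function_compare:
  fixes T T' :: "real \<Rightarrow> 'n::finite \<Rightarrow> 'a \<Rightarrow> real"
  assumes T: "tail_function T L" and T': "tail_function T' L"
    and L: "((\<lambda>m. L (\<lambda>_. m)) \<longlongrightarrow> 0) at_top"
    and h: "0 < h2" "h2 < h1" and e: "0 < e"
  shows "\<exists>B. (\<forall>\<^sub>F t in at_right 0. prob {x \<in> space M. h1 \<le> (\<Sum>i\<in>UNIV. T t i x)} / t \<le> B) \<and>
             (\<forall>\<^sub>F t in at_right 0. B \<le> prob {x \<in> space M. h2 < (\<Sum>i\<in>UNIV. T' t i x)} / t + e)"
proof -
  let ?n = "real CARD('n)"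
  \<comment> \<open>Rounding down to the grid, and the negative parts, each cost at most a third of \<open>h1 - h2\<close>.\<close>
  define d where "d = (h1 - h2) / (3 * ?n)"
  have d: "0 < d" using h by (simp add: d_def)
  have dn: "d * ?n = (h1 - h2) / 3" by (simp add: d_def)
  define h where "h = h1 - d * ?n"
  have hpos: "0 < h" using h by (simp add: h_def dn)
  have "\<forall>\<^sub>F m in at_top. L (\<lambda>_. m) < e / 4"
    by (rule order_tendstoD(2)[OF L]) (use e in simp)
  then obtain m0 where m0: "\<And>m. m0 \<le> m \<Longrightarrow> L (\<lambda>_. m) < e / 4"
    by (auto simp: eventually_at_top_linorder)
  \<comment> \<open>Coordinates beyond \<open>d * K\<close> contribute less than \<open>e / 4\<close> in the limit.\<close>
  obtain K0 :: nat where K0: "m0 / d \<le> real K0" using real_arch_simple by blast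
  define K where "K = Suc K0"
  have "m0 \<le> d * real K" using K0 d by (simp add: K_def field_simps)
  then have LK: "L (\<lambda>_. d * real K) < e / 4" by (rule m0)
  obtain b where b: "\<And>T. tail_function T L \<Longrightarrow>
      ((\<lambda>t. prob (grid_event (T t) d K h) / t) \<longlongrightarrow> b) (at_right 0)"
    using grid_event_limit[OF d hpos] by blast
  have pos: "\<forall>\<^sub>F t::real in at_right 0. 0 < t" by (simp add: eventually_at_right_less)
  have [measurable]: "T t i \<in> borel_measurable M" "T' t i \<in> borel_measurable M" for t i
    using T T' by (auto simp: tail_function_def)
  have "((\<lambda>t. prob {x \<in> space M. \<exists>i. d * real K < T t i x} / t) \<longlongrightarrow> L (\<lambda>_. d * real K)) (at_right 0)"
    using T d by (auto simp: tail_function_def K_def)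
  then have "\<forall>\<^sub>F t in at_right 0. prob {x \<in> space M. \<exists>i. d * real K < T t i x} / t < e / 4"
    using LK by (rule order_tendstoD)
  moreover have "\<forall>\<^sub>F t in at_right 0. prob (grid_event (T t) d K h) / t < b + e / 4"
    using e by (intro order_tendstoD(2)[OF b[OF T]]) simp
  ultimately have 1: "\<forall>\<^sub>F t in at_right 0. prob {x \<in> space M. h1 \<le> (\<Sum>i\<in>UNIV. T t i x)} / t \<le> b + e / 2"
    using pos
  proof eventually_elim
    case (elim t)
    let ?A = "{x \<in> space M. \<exists>i. d * real K < T t i x}"
    have G: "grid_event (T t) d K h \<in> sets M" by (rule grid_event_measurable) measurable
    have A: "?A \<in> sets M" by measurable
    have "prob {x \<in> space M. h1 \<le> (\<Sum>i\<in>UNIV. T t i x)} \<le> prob (?A \<union> grid_event (T t) d K h)"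
    proof (rule finite_measure_mono)
      show "{x \<in> space M. h1 \<le> (\<Sum>i\<in>UNIV. T t i x)} \<subseteq> ?A \<union> grid_event (T t) d K h"
        using grid_event_upper[OF d, of _ h "T t" K] by (fastforce simp: h_def K_def not_less)
    qed (use A G in auto)
    also have "\<dots> \<le> prob ?A + prob (grid_event (T t) d K h)"
      using A G by (rule measure_Un_le)
    finally show ?case
      using elim by (simp add: field_simps)
  qed
  have "\<forall>\<^sub>F t in at_right 0. \<forall>x\<in>space M. \<forall>i. - d \<le> T' t i x"
    using T' d by (auto simp: tail_function_def)
  moreover have "\<forall>\<^sub>F t in at_right 0. b - e / 2 < prob (grid_event (T' t) d K h) / t"
    using e by (intro order_tendstoD(1)[OF b[OF T']]) simp
  ultimately have 2: "\<forall>\<^sub>F t in at_right 0.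
      b + e / 2 \<le> prob {x \<in> space M. h2 < (\<Sum>i\<in>UNIV. T' t i x)} / t + e"
    using pos
  proof eventually_elim
    case (elim t)
    have "prob (grid_event (T' t) d K h) \<le> prob {x \<in> space M. h2 < (\<Sum>i\<in>UNIV. T' t i x)}"
    proof (rule finite_measure_mono)
      show "grid_event (T' t) d K h \<subseteq> {x \<in> space M. h2 < (\<Sum>i\<in>UNIV. T' t i x)}"
      proof
        fix x assume x: "x \<in> grid_event (T' t) d K h"
        then have xs: "x \<in> space M" by (auto simp: grid_event_def grid_cell_def cell_def)
        then have "h - d * ?n \<le> (\<Sum>i\<in>UNIV. T' t i x)"
          using elim by (intro grid_event_lower[OF d x]) auto
        moreover have "h2 < h - d * ?n" using h by (simp add: h_def dn field_simps)
        ultimately show "x \<in> {x \<in> space M. h2 < (\<Sum>i\<in>UNIV. T' t i x)}" using xs by simp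
      qed
    qed measurable
    then have "prob (grid_event (T' t) d K h) / t \<le> prob {x \<in> space M. h2 < (\<Sum>i\<in>UNIV. T' t i x)} / t"
      using elim by (simp add: divide_right_mono)
    with elim show ?case by simp
  qed
  show ?thesis by (rule exI[of _ "b + e / 2"]) (rule conjI[OF 1 2])
qed

end

section \<open>Tail constants and logarithmic averages\<close>

context prob_space
begin

text \<open>The nonnegative random variable \<open>Z\<close> satisfies \<open>Pr(Z > z) \<sim> k / z\<close> (with \<open>o(1 / z)\<close> if \<open>k = 0\<close>).\<close>

definition tail_const :: "('a \<Rightarrow> real) \<Rightarrow> real \<Rightarrow> bool" where
  "tail_const Z k \<longleftrightarrow> Z \<in> borel_measurable M \<and> (\<forall>x\<in>space M. 0 \<le> Z x) \<and>
     ((\<lambda>z. z * prob {x \<in> space M. z < Z x}) \<longlongrightarrow> k) at_top"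

lemma tail_const_scale:
  assumes Z: "tail_const Z k" and c: "0 \<le> c"
  shows "tail_const (\<lambda>x. c * Z x) (c * k)"
proof (cases "c = 0")
  case True
  have "((\<lambda>z::real. z * prob {x \<in> space M. z < 0}) \<longlongrightarrow> 0) at_top"
    by (rule tendsto_eventually) (use eventually_ge_at_top[of 0] in eventually_elim, simp)
  with True show ?thesis by (simp add: tail_const_def)
next
  case False
  with c have c: "0 < c" by simp
  have lim: "((\<lambda>z. z * prob {x \<in> space M. z < Z x}) \<longlongrightarrow> k) at_top"
    using Z by (simp add: tail_const_def)
  have "filterlim (\<lambda>z::real. z / c) at_top at_top"
    using c by real_asymp
  from tendsto_mult_left[OF filterlim_compose[OF lim this], of c]
  have "((\<lambda>z. z * prob {x \<in> space M. z < c * Z x}) \<longlongrightarrow> c * k) at_top"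
    using c by (simp add: pos_divide_less_eq mult.commute)
  moreover have "(\<lambda>x. c * Z x) \<in> borel_measurable M"
    using Z by (intro borel_measurable_times) (auto simp: tail_const_def)
  ultimately show ?thesis using Z c by (simp add: tail_const_def)
qed

text \<open>The logarithmic means of a convergent sequence tend to its limit, since \<open>harm N \<sim> ln N\<close>.\<close>

lemma log_average:
  fixes a :: "nat \<Rightarrow> real"
  assumes a: "a \<longlonglongrightarrow> k"
  shows "(\<lambda>N. (\<Sum>i=1..N. a i / real i) / ln (real N)) \<longlonglongrightarrow> k"
proof -
  have harm: "(\<lambda>N. harm N / ln (real N)) \<longlonglongrightarrow> (1::real)"
  proof -
    have "(\<lambda>N. (harm N - ln (real N)) / ln (real N)) \<longlonglongrightarrow> 0"
      by (rule tendsto_divide_0[OF euler_mascheroni_LIMSEQ]) (rule filterlim_at_top_imp_at_infinity, real_asymp)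
    then have "(\<lambda>N. (harm N - ln (real N)) / ln (real N) + 1) \<longlonglongrightarrow> 0 + 1"
      by (intro tendsto_intros)
    moreover have "\<forall>\<^sub>F N in sequentially. (harm N - ln (real N)) / ln (real N) + 1 = harm N / ln (real N)"
      using eventually_gt_at_top[of 1] by eventually_elim (simp add: field_simps)
    ultimately show ?thesis by (simp add: filterlim_cong)
  qed
  have "(\<lambda>N. (\<Sum>i=1..N. (a i - k) / real i) / ln (real N)) \<longlonglongrightarrow> 0"
  proof (rule LIMSEQ_I)
    fix e :: real assume e: "0 < e"
    obtain N0 where N0: "\<And>i. N0 \<le> i \<Longrightarrow> \<bar>a i - k\<bar> < e / 4"
      using LIMSEQ_D[OF a, of "e/4"] e by auto
    define C where "C = (\<Sum>i=1..N0. \<bar>a i - k\<bar> / real i)"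
    have ev1: "\<forall>\<^sub>F N in sequentially. C / ln (real N) < e / 4"
    proof (rule order_tendstoD(2))
      show "(\<lambda>N. C / ln (real N)) \<longlonglongrightarrow> 0" by real_asymp
    qed (use e in simp)
    have ev2: "\<forall>\<^sub>F N in sequentially. harm N / ln (real N) < (2::real)"
      by (rule order_tendstoD(2)[OF harm]) simp
    have "\<forall>\<^sub>F N in sequentially. \<bar>(\<Sum>i=1..N. (a i - k) / real i) / ln (real N)\<bar> < e"
      using ev1 ev2 eventually_gt_at_top[of 1] 
    proof eventually_elim
      case (elim N)
      have ln: "0 < ln (real N)" using elim by simp
      have "\<bar>\<Sum>i=1..N. (a i - k) / real i\<bar> \<le> (\<Sum>i=1..N. \<bar>a i - k\<bar> / real i)"
        by (rule order_trans[OF sum_abs]) (simp add: abs_divide)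
      also have "\<dots> \<le> (\<Sum>i=1..N. (if i \<le> N0 then \<bar>a i - k\<bar> / real i else 0) + e / 4 * inverse (real i))"
      proof (rule sum_mono)
        fix i assume "i \<in> {1..N}"
        show "\<bar>a i - k\<bar> / real i \<le> (if i \<le> N0 then \<bar>a i - k\<bar> / real i else 0) + e / 4 * inverse (real i)"
        proof (cases "i \<le> N0")
          case True
          then show ?thesis using e by simp
        next
          case False
          then have "\<bar>a i - k\<bar> \<le> e / 4" using N0[of i] by simp
          then have "\<bar>a i - k\<bar> * inverse (real i) \<le> e / 4 * inverse (real i)"
            by (rule mult_right_mono) simp
          then have "\<bar>a i - k\<bar> / real i \<le> e / 4 * inverse (real i)"
            unfolding divide_inverse[of _ "real i"] .
          with False show ?thesis by (simp only: if_False add_0_left)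
        qed
      qed
      also have "\<dots> = (\<Sum>i=1..N. if i \<le> N0 then \<bar>a i - k\<bar> / real i else 0) + e / 4 * harm N"
        unfolding sum.distrib harm_def sum_distrib_left[symmetric] ..
      also have "(\<Sum>i=1..N. if i \<le> N0 then \<bar>a i - k\<bar> / real i else 0) \<le> C"
        unfolding C_def sum.inter_filter[OF finite_atLeastAtMost, symmetric]
        by (intro sum_mono2) auto
      finally have "\<bar>\<Sum>i=1..N. (a i - k) / real i\<bar> \<le> C + e / 4 * harm N" by simp
      then have "\<bar>(\<Sum>i=1..N. (a i - k) / real i) / ln (real N)\<bar> \<le> (C + e / 4 * harm N) / ln (real N)"
        using ln by (simp add: abs_divide divide_right_mono)
      also have "\<dots> = C / ln (real N) + e / 4 * (harm N / ln (real N))"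
        by (simp add: add_divide_distrib)
      also have "\<dots> < e / 4 + e / 4 * 2"
        using elim e by (intro add_strict_mono mult_strict_left_mono) auto
      also have "\<dots> \<le> e" using e by simp
      finally show ?case .
    qed
    then show "\<exists>no. \<forall>n\<ge>no. norm ((\<Sum>i=1..n. (a i - k) / real i) / ln (real n) - 0) < e"
      by (simp add: eventually_sequentially)
  qed
  from tendsto_add[OF this tendsto_mult_left[OF harm, of k]]
  have "(\<lambda>N. (\<Sum>i=1..N. (a i - k) / real i) / ln (real N) + k * (harm N / ln (real N))) \<longlonglongrightarrow> k"
    by simp
  moreover have "(\<Sum>i=1..N. (a i - k) / real i) / ln (real N) + k * (harm N / ln (real N))
      = (\<Sum>i=1..N. a i / real i) / ln (real N)" for N
  proof -
    have "(\<Sum>i=1..N. (a i - k) / real i) = (\<Sum>i=1..N. a i / real i) - k * harm N"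
      by (simp add: left_diff_distrib sum_subtractf harm_def sum_distrib_left divide_inverse)
    then show ?thesis by (simp add: diff_divide_distrib)
  qed
  ultimately show ?thesis by simp
qed

text \<open>A discrete layer-cake formula: the sum is the expected number of \<open>k\<close> in \<open>{1..N}\<close> below \<open>Z\<close>.\<close>

lemma tail_sum_bounds:
  fixes Z :: "'a \<Rightarrow> real"
  assumes [measurable]: "Z \<in> borel_measurable M" and nn: "\<And>x. x \<in> space M \<Longrightarrow> 0 \<le> Z x"
  shows "(\<Sum>k=1..N. prob {x \<in> space M. real k < Z x}) \<le> expectation (\<lambda>x. min (Z x) (real N))"
    and "expectation (\<lambda>x. min (Z x) (real N)) \<le> (\<Sum>k=1..N. prob {x \<in> space M. real k < Z x}) + 1"
    and "integrable M (\<lambda>x. min (Z x) (real N))"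
proof -
  show int: "integrable M (\<lambda>x. min (Z x) (real N))"
    by (rule integrable_const_bound[where B="real N"]) (use nn in \<open>force intro!: AE_I2 simp: abs_le_iff min_def\<close>, measurable)
  let ?c = "\<lambda>x. \<Sum>k=1..N. indicator {x \<in> space M. real k < Z x} x :: real"
  have bounds: "?c x \<le> min (Z x) (real N) \<and> min (Z x) (real N) \<le> ?c x + 1" if x: "x \<in> space M" for x
  proof -
    \<comment> \<open>The number of positive integers below \<open>Z x\<close>.\<close>
    define m where "m = nat (\<lceil>Z x\<rceil> - 1)"
    have m: "real k < Z x \<longleftrightarrow> k \<le> m" if "1 \<le> k" for k
      using that unfolding m_def by linarith
    have "?c x = (\<Sum>k=1..N. of_bool (k \<le> m))"
      using x m by (intro sum.cong) (auto simp: indicator_def)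
    also have "\<dots> = real (card {k\<in>{1..N}. k \<le> m})"
      by (simp add: sum.inter_filter[symmetric] of_bool_def)
    also have "{k\<in>{1..N}. k \<le> m} = {1..min N m}" by auto
    finally have c: "?c x = real (min N m)" by simp
    have "real m \<le> Z x" "Z x \<le> real m + 1"
      using nn[OF x] unfolding m_def by linarith+
    then show ?thesis unfolding c by (auto simp: min_def)
  qed
  have intc: "integrable M ?c"
    by (intro Bochner_Integration.integrable_sum integrable_real_indicator) (auto simp: emeasure_eq_measure)
  have exp: "expectation ?c = (\<Sum>k=1..N. prob {x \<in> space M. real k < Z x})"
    by (subst Bochner_Integration.integral_sum) (auto simp: emeasure_eq_measure intro!: sum.cong)
  show "(\<Sum>k=1..N. prob {x \<in> space M. real k < Z x}) \<le> expectation (\<lambda>x. min (Z x) (real N))"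
    unfolding exp[symmetric] using bounds by (intro integral_mono intc int) auto
  have "expectation (\<lambda>x. min (Z x) (real N)) \<le> expectation (\<lambda>x. ?c x + 1)"
    using bounds by (intro integral_mono int Bochner_Integration.integrable_add intc) auto
  also have "\<dots> = expectation ?c + 1" using intc by (simp add: prob_space)
  finally show "expectation (\<lambda>x. min (Z x) (real N)) \<le> (\<Sum>k=1..N. prob {x \<in> space M. real k < Z x}) + 1"
    unfolding exp .
qed

lemma truncated_mean_limit:
  assumes Z: "tail_const Z k"
  shows "(\<lambda>N. expectation (\<lambda>x. min (Z x) (real N)) / ln (real N)) \<longlonglongrightarrow> k"
proof -
  have meas: "Z \<in> borel_measurable M" and nn: "\<And>x. x \<in> space M \<Longrightarrow> 0 \<le> Z x"
    and lim: "((\<lambda>z. z * prob {x \<in> space M. z < Z x}) \<longlongrightarrow> k) at_top"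
    using Z by (auto simp: tail_const_def)
  let ?S = "\<lambda>N. \<Sum>i=1..N. prob {x \<in> space M. real i < Z x}"
  have "(\<lambda>N. (\<Sum>i=1..N. (real i * prob {x \<in> space M. real i < Z x}) / real i) / ln (real N)) \<longlonglongrightarrow> k"
    by (intro log_average filterlim_compose[OF lim] filterlim_real_sequentially)
  also have "(\<lambda>N. (\<Sum>i=1..N. (real i * prob {x \<in> space M. real i < Z x}) / real i) / ln (real N))
      = (\<lambda>N. ?S N / ln (real N))"
    by (intro ext arg_cong2[where f="(/)"] sum.cong) auto
  finally have S: "(\<lambda>N. ?S N / ln (real N)) \<longlonglongrightarrow> k" .
  have "(\<lambda>N. 1 / ln (real N)) \<longlonglongrightarrow> 0" by real_asymp
  from tendsto_add[OF S this] have S': "(\<lambda>N. (?S N + 1) / ln (real N)) \<longlonglongrightarrow> k"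
    by (simp add: add_divide_distrib)
  show ?thesis
  proof (rule tendsto_sandwich[OF _ _ S S'])
    show "\<forall>\<^sub>F N in sequentially. ?S N / ln (real N) \<le> expectation (\<lambda>x. min (Z x) (real N)) / ln (real N)"
      using eventually_gt_at_top[of 1]
      by eventually_elim (intro divide_right_mono tail_sum_bounds meas nn, auto)
    show "\<forall>\<^sub>F N in sequentially. expectation (\<lambda>x. min (Z x) (real N)) / ln (real N) \<le> (?S N + 1) / ln (real N)"
      using eventually_gt_at_top[of 1]
      by eventually_elim (intro divide_right_mono tail_sum_bounds meas nn, auto)
  qed
qed

text \<open>Tail constants are monotone under domination of sums, and hence additive. Truncating each
  summand or truncating the sum makes no difference, as the levels differ by a constant factor
  and \<open>ln (m * N) \<sim> ln N\<close>.\<close>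

lemma tail_const_sum_mono:
  fixes Z :: "'i \<Rightarrow> 'a \<Rightarrow> real" and W :: "'j \<Rightarrow> 'a \<Rightarrow> real"
  assumes fin: "finite I" "finite J"
    and Z: "\<And>i. i \<in> I \<Longrightarrow> tail_const (Z i) (k i)"
    and W: "\<And>j. j \<in> J \<Longrightarrow> tail_const (W j) (l j)"
    and le: "\<And>x. x \<in> space M \<Longrightarrow> (\<Sum>i\<in>I. Z i x) \<le> (\<Sum>j\<in>J. W j x)"
  shows "(\<Sum>i\<in>I. k i) \<le> (\<Sum>j\<in>J. l j)"
proof -
  define m where "m = Suc (card I)"
  have m: "0 < m" "card I \<le> m" by (auto simp: m_def)
  have nnZ: "0 \<le> Z i x" if "i \<in> I" "x \<in> space M" for i x using Z[OF that(1)] that by (auto simp: tail_const_def)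
  have nnW: "0 \<le> W i x" if "i \<in> J" "x \<in> space M" for i x using W[OF that(1)] that by (auto simp: tail_const_def)
  have intZ: "integrable M (\<lambda>x. min (Z i x) (real N))" if "i \<in> I" for i N
    using Z[OF that] by (intro tail_sum_bounds) (auto simp: tail_const_def)
  have intW: "integrable M (\<lambda>x. min (W i x) (real N))" if "i \<in> J" for i N
    using W[OF that] by (intro tail_sum_bounds) (auto simp: tail_const_def)
  have pt: "(\<Sum>i\<in>I. min (Z i x) (real N)) \<le> (\<Sum>j\<in>J. min (W j x) (real (m * N)))"
    if x: "x \<in> space M" for x N
  proof (cases "\<exists>j\<in>J. real (m * N) < W j x")
    case True
    then obtain j where j: "j \<in> J" "real (m * N) < W j x" by blast
    have "(\<Sum>i\<in>I. min (Z i x) (real N)) \<le> (\<Sum>i\<in>I. real N)" by (intro sum_mono) simp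
    also have "\<dots> \<le> real (m * N)" using m by (simp add: mult_right_mono)
    also have "\<dots> = min (W j x) (real (m * N))" using j by simp
    also have "\<dots> \<le> (\<Sum>j\<in>J. min (W j x) (real (m * N)))"
      using fin j nnW[OF _ x] by (intro member_le_sum) auto
    finally show ?thesis .
  next
    case False
    have "(\<Sum>i\<in>I. min (Z i x) (real N)) \<le> (\<Sum>i\<in>I. Z i x)" by (intro sum_mono) simp
    also have "\<dots> \<le> (\<Sum>j\<in>J. W j x)" by (rule le[OF x])
    also have "\<dots> = (\<Sum>j\<in>J. min (W j x) (real (m * N)))"
      using False by (intro sum.cong) (auto simp: not_less)
    finally show ?thesis .
  qed
  have limZ: "(\<lambda>N. \<Sum>i\<in>I. expectation (\<lambda>x. min (Z i x) (real N)) / ln (real N)) \<longlonglongrightarrow> (\<Sum>i\<in>I. k i)"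
    by (intro tendsto_sum truncated_mean_limit Z)
  have limW: "(\<lambda>N. (\<Sum>j\<in>J. expectation (\<lambda>x. min (W j x) (real (m * N))) / ln (real (m * N)))
       * (ln (real (m * N)) / ln (real N))) \<longlonglongrightarrow> (\<Sum>j\<in>J. l j) * 1"
  proof (intro tendsto_mult tendsto_sum)
    fix j assume j: "j \<in> J"
    have "filterlim (\<lambda>N. m * N) sequentially sequentially"
      using m by (intro mult_nat_left_at_top) simp
    from filterlim_compose[OF truncated_mean_limit[OF W[OF j]] this]
    show "(\<lambda>N. expectation (\<lambda>x. min (W j x) (real (m * N))) / ln (real (m * N))) \<longlonglongrightarrow> l j" .
  next
    show "(\<lambda>N. ln (real (m * N)) / ln (real N)) \<longlonglongrightarrow> 1"
      using m unfolding of_nat_mult by real_asymp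
  qed
  have "(\<Sum>i\<in>I. k i) \<le> (\<Sum>j\<in>J. l j) * 1"
  proof (rule tendsto_le[OF _ limW limZ])
    show "\<forall>\<^sub>F N in sequentially. (\<Sum>i\<in>I. expectation (\<lambda>x. min (Z i x) (real N)) / ln (real N))
      \<le> (\<Sum>j\<in>J. expectation (\<lambda>x. min (W j x) (real (m * N))) / ln (real (m * N)))
       * (ln (real (m * N)) / ln (real N))"
      using eventually_gt_at_top[of 1]
    proof eventually_elim
      case (elim N)
      have ln: "0 < ln (real N)" "ln (real (m * N)) \<noteq> 0"
      proof -
        have "1 < m * N" using elim m by (metis less_1_mult mult_1 nat_neq_iff less_one)
        then have "1 < real (m * N)" by linarith
        then have "0 < ln (real (m * N))" by (rule ln_gt_zero)
        then show "ln (real (m * N)) \<noteq> 0" by simp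
      qed (use elim in simp)
      have "(\<Sum>i\<in>I. expectation (\<lambda>x. min (Z i x) (real N)))
          = expectation (\<lambda>x. \<Sum>i\<in>I. min (Z i x) (real N))"
        by (simp add: intZ)
      also have "\<dots> \<le> expectation (\<lambda>x. \<Sum>j\<in>J. min (W j x) (real (m * N)))"
        by (intro integral_mono Bochner_Integration.integrable_sum intZ intW pt)
      also have "\<dots> = (\<Sum>j\<in>J. expectation (\<lambda>x. min (W j x) (real (m * N))))"
        by (intro Bochner_Integration.integral_sum intW)
      finally show ?case using ln
        by (simp add: sum_divide_distrib[symmetric] divide_right_mono)
    qed
  qed simp
  then show ?thesis by simp
qed

end

section \<open>Homogeneous functions on the nonnegative orthant\<close>

text \<open>The standard simplex.\<close>

definition simplex1 :: "('n::finite \<Rightarrow> real) set" where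
  "simplex1 = {y. (\<forall>i. 0 \<le> y i) \<and> (\<Sum>i\<in>UNIV. y i) = 1}"

lemma compact_simplex1: "compact (simplex1 :: ('n::finite \<Rightarrow> real) set)"
proof -
  have "compactin (product_topology (\<lambda>_::'n. euclidean :: real topology) UNIV) (PiE UNIV (\<lambda>_. {0..1}))"
    by (simp add: compactin_PiE)
  then have cube: "compact (PiE UNIV (\<lambda>_. {0..1}) :: ('n \<Rightarrow> real) set)"
    by (simp add: euclidean_product_topology)
  have "closed {y :: 'n \<Rightarrow> real. (\<forall>i. 0 \<le> y i) \<and> (\<Sum>i\<in>UNIV. y i) = 1}"
    by (intro closed_Collect_conj closed_Collect_all closed_Collect_le closed_Collect_eq
        continuous_intros continuous_on_product_coordinates)
  then have closed: "closed (simplex1 :: ('n \<Rightarrow> real) set)" unfolding simplex1_def .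
  have "y i \<le> 1" if "y \<in> simplex1" for y :: "'n \<Rightarrow> real" and i
    using member_le_sum[of i UNIV y] that by (auto simp: simplex1_def)
  then have "simplex1 = (PiE UNIV (\<lambda>_. {0..1})) \<inter> (simplex1 :: ('n \<Rightarrow> real) set)"
    by (auto simp: simplex1_def PiE_def)
  with compact_Int_closed[OF cube closed] show ?thesis by simp
qed

text \<open>If \<open>g \<ge> 0\<close> vanishes only where \<open>f \<le> 0\<close>, then \<open>f\<close> is bounded by a multiple of \<open>g\<close> up to a small
  multiple of the coordinate sum: on the compact part of the simplex where \<open>f \<ge> e\<close>, the minimum
  of \<open>g\<close> is positive.\<close>

lemma homogeneous_dominated:
  fixes f g :: "('n::finite \<Rightarrow> real) \<Rightarrow> real"
  assumes cont: "continuous_on simplex1 f" "continuous_on simplex1 g"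
    and f: "\<And>c y. 0 < c \<Longrightarrow> (\<And>i. 0 \<le> y i) \<Longrightarrow> f (\<lambda>i. c * y i) = c * f y"
    and g: "\<And>c y. 0 < c \<Longrightarrow> (\<And>i. 0 \<le> y i) \<Longrightarrow> g (\<lambda>i. c * y i) = c * g y"
    and nonneg: "\<And>y. y \<in> simplex1 \<Longrightarrow> 0 \<le> g y"
    and zero: "\<And>y. y \<in> simplex1 \<Longrightarrow> g y = 0 \<Longrightarrow> f y \<le> 0"
    and e: "0 < e"
  obtains C where "0 \<le> C" "\<And>y. (\<And>i. 0 \<le> y i) \<Longrightarrow> f y \<le> e * (\<Sum>i\<in>UNIV. y i) + C * g y"
proof -
  define K where "K = simplex1 \<inter> f -` {e..}"
  have "closed K"
    unfolding K_def by (intro continuous_closed_preimage cont closed_atLeast compact_imp_closed compact_simplex1)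
  moreover have "simplex1 \<inter> K = K" by (auto simp: K_def)
  ultimately have K: "compact K" using compact_Int_closed[OF compact_simplex1, of K] by simp
  have contK: "continuous_on K f" "continuous_on K g"
    using cont by (auto intro: continuous_on_subset simp: K_def)
  obtain C where C: "0 \<le> C" "\<And>y. y \<in> simplex1 \<Longrightarrow> f y \<le> e + C * g y"
  proof (cases "K = {}")
    case True
    then have "f y \<le> e + 0 * g y" if "y \<in> simplex1" for y
      using that by (auto simp: K_def)
    then show ?thesis by (intro that[of 0]) auto
  next
    case False
    obtain y0 where y0: "y0 \<in> K" "\<And>y. y \<in> K \<Longrightarrow> g y0 \<le> g y"
      using continuous_attains_inf[OF K False contK(2)] by blast
    obtain y1 where y1: "y1 \<in> K" "\<And>y. y \<in> K \<Longrightarrow> f y \<le> f y1"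
      using continuous_attains_sup[OF K False contK(1)] by blast
    have pos: "0 < g y0"
      using y0(1) nonneg[of y0] zero[of y0] e by (force simp: K_def)
    have pos1: "0 < f y1" using y1(1) e by (auto simp: K_def)
    show ?thesis
    proof (rule that[of "f y1 / g y0"])
      show "0 \<le> f y1 / g y0" using pos pos1 by simp
      fix y :: "'n \<Rightarrow> real" assume y: "y \<in> simplex1"
      show "f y \<le> e + f y1 / g y0 * g y"
      proof (cases "y \<in> K")
        case True
        have "f y \<le> f y1 / g y0 * g y0" using y1(2)[OF True] pos by simp
        also have "\<dots> \<le> f y1 / g y0 * g y"
          using pos pos1 y0(2)[OF True] by (intro mult_left_mono) auto
        finally show ?thesis using e by simp
      next
        case False
        have "0 \<le> f y1 / g y0 * g y"
          using pos pos1 nonneg[OF y] by simp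
        moreover have "f y < e" using False y by (auto simp: K_def)
        ultimately show ?thesis by linarith
      qed
    qed
  qed
  show ?thesis
  proof (rule that[OF C(1)])
    fix y :: "'n \<Rightarrow> real" assume y: "\<And>i. 0 \<le> y i"
    define s where "s = (\<Sum>i\<in>UNIV. y i)"
    show "f y \<le> e * (\<Sum>i\<in>UNIV. y i) + C * g y"
    proof (cases "s = 0")
      case True
      then have "y = (\<lambda>_. 0)"
        using y sum_nonneg_eq_0_iff[of UNIV y] by (auto simp: s_def)
      moreover have "f (\<lambda>_. 0) = 0" "g (\<lambda>_. 0) = 0"
        using f[of 2 "\<lambda>_. 0"] g[of 2 "\<lambda>_. 0"] by simp_all
      ultimately show ?thesis by simp
    next
      case False
      have "0 \<le> s" using y by (auto simp: s_def intro: sum_nonneg)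
      with False have s: "0 < s" by simp
      have "(\<lambda>i. inverse s * y i) \<in> simplex1"
        using s y by (simp add: simplex1_def sum_distrib_left[symmetric] s_def[symmetric])
      from C(2)[OF this] have "inverse s * f y \<le> e + C * (inverse s * g y)"
        using f[of "inverse s" y] g[of "inverse s" y] s y by simp
      then have "s * (inverse s * f y) \<le> s * (e + C * (inverse s * g y))"
        using s by (intro mult_left_mono) auto
      moreover have "s * (inverse s * a) = a" for a using s by simp
      moreover have "s * (e + C * (inverse s * g y)) = e * s + C * (s * (inverse s * g y))"
        by (simp add: algebra_simps)
      ultimately show ?thesis by (simp only: s_def[symmetric])
    qed
  qed
qed

text \<open>The \<open>p\<close>-norm, a quasi-norm if \<open>p < 1\<close>, of a vector with nonnegative coordinates.\<close>

definition pnorm :: "real \<Rightarrow> ('n::finite \<Rightarrow> real) \<Rightarrow> real" where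
  "pnorm p y = (\<Sum>i\<in>UNIV. y i powr p) powr (1 / p)"

text \<open>The weighted maximum of the coordinates.\<close>

definition wmax :: "('n::finite \<Rightarrow> real) \<Rightarrow> ('n \<Rightarrow> real) \<Rightarrow> real" where
  "wmax c y = Max (range (\<lambda>i. c i * y i))"

lemma wmax_greater_iff: "z < wmax c y \<longleftrightarrow> (\<exists>i. z < c i * y i)"
  unfolding wmax_def by (subst Max_gr_iff) auto

lemma wmax_le_iff: "wmax c y \<le> z \<longleftrightarrow> (\<forall>i. c i * y i \<le> z)"
  unfolding wmax_def by (subst Max_le_iff) auto

lemma le_wmax: "c i * y i \<le> wmax c y"
  using wmax_le_iff[of c y "wmax c y"] by auto

lemma wmax_attained: obtains i where "wmax c y = c i * y i"
proof -
  have "wmax c y \<in> range (\<lambda>i. c i * y i)" unfolding wmax_def by (rule Max_in) auto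
  with that show ?thesis by blast
qed

lemma pnorm_power:
  assumes "0 < p" shows "pnorm p y powr p = (\<Sum>i\<in>UNIV. y i powr p)"
  using assms by (simp add: pnorm_def powr_powr sum_nonneg powr_one')

lemma pnorm_nonneg: "0 \<le> pnorm p y" by (simp add: pnorm_def)

lemma pnorm_scale:
  assumes "0 < p" "0 < c" "\<And>i. 0 \<le> y i"
  shows "pnorm p (\<lambda>i. c * y i) = c * pnorm p y"
  using assms by (simp add: pnorm_def powr_mult sum_distrib_left[symmetric] sum_nonneg powr_powr)

lemma wmax_scale:
  assumes "0 < k"
  shows "wmax c (\<lambda>i. k * y i) = k * wmax c y"
proof (rule antisym)
  show "wmax c (\<lambda>i. k * y i) \<le> k * wmax c y"
    using assms le_wmax[of c _ y] by (auto simp: wmax_le_iff mult.left_commute)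
  obtain j where "wmax c y = c j * y j" by (rule wmax_attained)
  then show "k * wmax c y \<le> wmax c (\<lambda>i. k * y i)"
    using le_wmax[of c j "\<lambda>i. k * y i"] by (simp add: mult.left_commute)
qed

lemma continuous_on_pnorm:
  assumes "0 < p" shows "continuous_on simplex1 (pnorm p)"
  unfolding pnorm_def using assms
  by (intro continuous_on_powr' continuous_on_sum continuous_on_const ballI)
     (auto simp: simplex1_def sum_nonneg intro: continuous_on_subset[OF continuous_on_product_coordinates])

lemma continuous_on_wmax: "continuous_on A (wmax c)"
proof -
  have "continuous_on A (\<lambda>y. Max ((\<lambda>i. c i * y i) ` I))" if "finite I" "I \<noteq> {}" for I
    using that
  proof (induction I rule: finite_ne_induct)
    case (singleton i)
    then show ?case
      by (auto intro!: continuous_intros intro: continuous_on_subset[OF continuous_on_product_coordinates])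
  next
    case (insert i I)
    have "continuous_on A (\<lambda>y. max (c i * y i) (Max ((\<lambda>i. c i * y i) ` I)))"
      by (intro continuous_on_max continuous_on_mult continuous_on_const insert.IH
          continuous_on_subset[OF continuous_on_product_coordinates subset_UNIV])
    with insert.hyps show ?case by simp
  qed
  from this[of UNIV] show ?thesis by (simp add: wmax_def[abs_def])
qed

lemma pnorm_antimono:
  assumes p: "0 < p1" "p1 \<le> p2" and y: "\<And>i. 0 \<le> y i"
  shows "pnorm p2 y \<le> pnorm p1 y"
proof (cases "pnorm p1 y = 0")
  case True
  then have "(\<Sum>i\<in>UNIV. y i powr p1) = 0" by (simp add: pnorm_def)
  then have "y i = 0" for i by (subst (asm) sum_nonneg_eq_0_iff) auto
  then show ?thesis by (simp add: pnorm_def)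
next
  case False
  define h where "h = pnorm p1 y"
  have h: "0 < h" using False pnorm_nonneg[of p1 y] by (simp add: h_def)
  have le: "y i \<le> h" for i
  proof -
    have "y i powr p1 \<le> h powr p1"
      unfolding h_def pnorm_power[OF p(1)] by (rule member_le_sum) auto
    moreover have "h powr p1 < y i powr p1" if "h < y i"
      using that h p by (intro powr_less_mono2) auto
    ultimately show ?thesis by force
  qed
  have "y i powr p2 \<le> y i powr p1 * h powr (p2 - p1)" for i
  proof -
    have "y i powr p2 = y i powr p1 * y i powr (p2 - p1)" by (simp add: powr_add[symmetric])
    also have "\<dots> \<le> y i powr p1 * h powr (p2 - p1)"
      using le[of i] y[of i] p by (intro mult_left_mono powr_mono2) auto
    finally show ?thesis .
  qed
  then have "(\<Sum>i\<in>UNIV. y i powr p2) \<le> (\<Sum>i\<in>UNIV. y i powr p1 * h powr (p2 - p1))"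
    by (intro sum_mono)
  also have "\<dots> = h powr p1 * h powr (p2 - p1)"
    using p by (simp add: sum_distrib_right[symmetric] h_def pnorm_power)
  also have "\<dots> = h powr p2" by (simp add: powr_add[symmetric])
  finally have "pnorm p2 y \<le> (h powr p2) powr (1 / p2)"
    unfolding pnorm_def using p by (intro powr_mono2) (auto intro: sum_nonneg)
  also have "\<dots> = h" using p h by (simp add: powr_powr)
  finally show ?thesis by (simp add: h_def)
qed

lemma wmax_le_pnorm:
  assumes p: "0 < p" and y: "\<And>i. 0 \<le> y i"
  shows "wmax (\<lambda>_. 1) y \<le> pnorm p y"
proof -
  have "y i \<le> pnorm p y" for i
  proof -
    have "(y i powr p) powr (1 / p) \<le> pnorm p y"
      unfolding pnorm_def using p by (intro powr_mono2 member_le_sum) auto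
    then show ?thesis using p y[of i] by (simp add: powr_powr)
  qed
  then show ?thesis by (simp add: wmax_le_iff)
qed

lemma pnorm_eq_imp_single:
  fixes y :: "'n::finite \<Rightarrow> real"
  assumes p: "0 < p1" "p1 < p2" and y: "\<And>i. 0 \<le> y i"
    and eq: "pnorm p1 y = pnorm p2 y"
  obtains j where "\<And>i. i \<noteq> j \<Longrightarrow> y i = 0"
proof (cases "pnorm p1 y = 0")
  case True
  then have "(\<Sum>i\<in>UNIV. y i powr p1) = 0" by (simp add: pnorm_def)
  then have "y i = 0" for i by (subst (asm) sum_nonneg_eq_0_iff) auto
  with that show ?thesis by blast
next
  case False
  define h where "h = pnorm p1 y"
  have h: "0 < h" using False pnorm_nonneg[of p1 y] by (simp add: h_def)
  define u where "u i = inverse h * y i" for i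
  have u0: "0 \<le> u i" for i using h y by (simp add: u_def)
  have n: "pnorm p1 u = 1" "pnorm p2 u = 1"
    using pnorm_scale[of p1 "inverse h" y] pnorm_scale[of p2 "inverse h" y] p h y eq
    by (auto simp: u_def[abs_def] h_def)
  have s: "(\<Sum>i\<in>UNIV. u i powr p1) = 1" "(\<Sum>i\<in>UNIV. u i powr p2) = 1"
    using pnorm_power[of p1 u] pnorm_power[of p2 u] p n by auto
  have u1: "u i \<le> 1" for i
  proof -
    have "1 * u i \<le> wmax (\<lambda>_. 1) u" by (rule le_wmax[where c="\<lambda>_. 1"])
    also have "\<dots> \<le> pnorm p1 u" using p u0 by (intro wmax_le_pnorm) auto
    finally show ?thesis by (simp add: n)
  qed
  have le: "u i powr p2 \<le> u i powr p1" for i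
    using u0[of i] u1[of i] p by (cases "u i = 0") (auto intro!: powr_mono')
  have "(\<Sum>i\<in>UNIV. u i powr p1 - u i powr p2) = 0" using s by (simp add: sum_subtractf)
  then have eqi: "u i powr p1 = u i powr p2" for i
    using le by (subst (asm) sum_nonneg_eq_0_iff) auto
  have u01: "u i = 0 \<or> u i = 1" for i
  proof (rule ccontr)
    assume "\<not> (u i = 0 \<or> u i = 1)"
    then have "0 < u i" "u i < 1" using u0[of i] u1[of i] by auto
    then show False using eqi[of i] p powr_less_mono'[of "u i" p1 p2] by simp
  qed
  have "\<exists>j. u j \<noteq> 0"
  proof (rule ccontr)
    assume "\<not> (\<exists>j. u j \<noteq> 0)"
    then have "(\<Sum>i\<in>UNIV. u i powr p1) = 0" by simp
    with s show False by simp
  qed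
  then obtain j where j: "u j = 1" using u01 by blast
  have "(\<Sum>i\<in>UNIV. u i powr p1) = u j powr p1 + (\<Sum>i\<in>UNIV - {j}. u i powr p1)"
    by (intro sum.remove) auto
  with s j have "(\<Sum>i\<in>UNIV - {j}. u i powr p1) = 0" by simp
  then have "u i = 0" if "i \<noteq> j" for i
    using that by (subst (asm) sum_nonneg_eq_0_iff) auto
  then have "y i = 0" if "i \<noteq> j" for i using that h by (auto simp: u_def)
  with that show ?thesis by blast
qed

text \<open>If two norms of a nonnegative vector agree, then at most one coordinate is nonzero, and the
  weighted sum equals the weighted maximum.\<close>

lemma weighted_sum_minus_max_dominated:
  fixes c :: "'n::finite \<Rightarrow> real"
  assumes p: "0 < p1" "p1 < p2" and c: "\<And>i. 0 \<le> c i" and e: "0 < e"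
  shows "\<exists>C\<ge>0. \<forall>y. (\<forall>i. 0 \<le> y i) \<longrightarrow> (\<Sum>i\<in>UNIV. c i * y i) + C * pnorm p2 y
        \<le> wmax c y + e * (\<Sum>i\<in>UNIV. y i) + C * pnorm p1 y"
proof -
  let ?f = "\<lambda>y. (\<Sum>i\<in>UNIV. c i * y i) - wmax c y"
  let ?g = "\<lambda>y. pnorm p1 y - pnorm p2 y"
  have cf: "continuous_on simplex1 ?f"
    by (intro continuous_on_diff continuous_on_sum continuous_on_mult continuous_on_const continuous_on_wmax
        continuous_on_subset[OF continuous_on_product_coordinates subset_UNIV])
  have cg: "continuous_on simplex1 ?g"
    using p by (intro continuous_on_diff continuous_on_pnorm) auto
  obtain C where C: "0 \<le> C" "\<And>y. (\<And>i. 0 \<le> y i) \<Longrightarrow> ?f y \<le> e * (\<Sum>i\<in>UNIV. y i) + C * ?g y"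
  proof (rule homogeneous_dominated[OF cf cg _ _ _ _ e])
    show "?f (\<lambda>i. k * y i) = k * ?f y" if "0 < k" for k y
      using that by (simp add: wmax_scale sum_distrib_left right_diff_distrib mult.left_commute)
    show "?g (\<lambda>i. k * y i) = k * ?g y" if "0 < k" "\<And>i. 0 \<le> y i" for k y
      using that p by (simp add: pnorm_scale right_diff_distrib)
    show "0 \<le> ?g y" if "y \<in> simplex1" for y
      using that p pnorm_antimono[of p1 p2 y] by (auto simp: simplex1_def)
    show "?f y \<le> 0" if "y \<in> simplex1" "?g y = 0" for y
    proof -
      have y: "\<And>i. 0 \<le> y i" using that by (auto simp: simplex1_def)
      have eq: "pnorm p1 y = pnorm p2 y" using that by simp
      obtain j where j: "\<And>i. i \<noteq> j \<Longrightarrow> y i = 0"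
        using pnorm_eq_imp_single[OF p y eq] by blast
      have "(\<Sum>i\<in>UNIV. c i * y i) = (\<Sum>i\<in>{j}. c i * y i)"
        by (rule sum.mono_neutral_right) (auto simp: j)
      then show ?thesis using le_wmax[of c j y] by simp
    qed
  qed blast
  show ?thesis
  proof (intro exI[of _ C] conjI allI impI C(1))
    fix y :: "'n \<Rightarrow> real" assume "\<forall>i. 0 \<le> y i"
    with C(2)[of y] show "(\<Sum>i\<in>UNIV. c i * y i) + C * pnorm p2 y
        \<le> wmax c y + e * (\<Sum>i\<in>UNIV. y i) + C * pnorm p1 y"
      by (simp add: algebra_simps)
  qed
qed

text \<open>If the sum of a nonnegative vector equals its maximum, then at most one coordinate is nonzero,
  and every norm equals the maximum.\<close>

lemma pnorm_minus_max_dominated: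
  assumes p: "0 < p" and e: "0 < e"
  shows "\<exists>C\<ge>0. \<forall>y :: 'n::finite \<Rightarrow> real. (\<forall>i. 0 \<le> y i) \<longrightarrow> pnorm p y + C * wmax (\<lambda>_. 1) y
        \<le> wmax (\<lambda>_. 1) y + (e + C) * (\<Sum>i\<in>UNIV. y i)"
proof -
  let ?f = "\<lambda>y :: 'n \<Rightarrow> real. pnorm p y - wmax (\<lambda>_. 1) y"
  let ?g = "\<lambda>y :: 'n \<Rightarrow> real. (\<Sum>i\<in>UNIV. y i) - wmax (\<lambda>_. 1) y"
  have cf: "continuous_on simplex1 ?f"
    using p by (intro continuous_on_diff continuous_on_pnorm continuous_on_wmax)
  have cg: "continuous_on simplex1 ?g"
    by (intro continuous_on_diff continuous_on_sum continuous_on_wmax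
        continuous_on_subset[OF continuous_on_product_coordinates subset_UNIV])
  obtain C where C: "0 \<le> C" "\<And>y. (\<And>i. 0 \<le> y i) \<Longrightarrow> ?f y \<le> e * (\<Sum>i\<in>UNIV. y i) + C * ?g y"
  proof (rule homogeneous_dominated[OF cf cg _ _ _ _ e])
    show "?f (\<lambda>i. k * y i) = k * ?f y" if "0 < k" "\<And>i. 0 \<le> y i" for k y
      using that p by (simp add: wmax_scale pnorm_scale right_diff_distrib)
    show "?g (\<lambda>i. k * y i) = k * ?g y" if "0 < k" for k y
      using that by (simp add: wmax_scale sum_distrib_left right_diff_distrib)
    show "0 \<le> ?g y" if "y \<in> simplex1" for y
      using that member_le_sum[of _ UNIV y] by (auto simp: simplex1_def wmax_le_iff)
    show "?f y \<le> 0" if ys: "y \<in> simplex1" "?g y = 0" for y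
    proof -
      have y: "\<And>i. 0 \<le> y i" using ys by (auto simp: simplex1_def)
      obtain j where j: "wmax (\<lambda>_. 1) y = 1 * y j" by (rule wmax_attained)
      have "(\<Sum>i\<in>UNIV. y i) = y j + (\<Sum>i\<in>UNIV - {j}. y i)"
        by (intro sum.remove) auto
      with ys(2) j have "(\<Sum>i\<in>UNIV - {j}. y i) = 0" by simp
      then have z: "y i = 0" if "i \<noteq> j" for i
        using that y by (subst (asm) sum_nonneg_eq_0_iff) auto
      have "(\<Sum>i\<in>UNIV. y i powr p) = (\<Sum>i\<in>{j}. y i powr p)"
        by (rule sum.mono_neutral_right) (auto simp: z)
      then have "pnorm p y = y j" using p y[of j] by (simp add: pnorm_def powr_powr)
      with j show ?thesis by simp
    qed
  qed blast
  show ?thesis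
  proof (intro exI[of _ C] conjI allI impI C(1))
    fix y :: "'n \<Rightarrow> real" assume "\<forall>i. 0 \<le> y i"
    with C(2)[of y] show "pnorm p y + C * wmax (\<lambda>_. 1) y
        \<le> wmax (\<lambda>_. 1) y + (e + C) * (\<Sum>i\<in>UNIV. y i)"
      by (simp add: algebra_simps)
  qed
qed

section \<open>Quantiles of heavy-tailed distributions\<close>

lemma is_cdf_properties:
  assumes "is_cdf F"
  shows is_cdf_mono: "mono F"
    and is_cdf_right_cont: "continuous (at_right x) F"
    and is_cdf_at_top: "(F \<longlongrightarrow> 1) at_top"
    and is_cdf_at_bot: "(F \<longlongrightarrow> 0) at_bot"
    and is_cdf_bounds: "0 \<le> F x" "F x \<le> 1"
proof -
  obtain N where N: "real_distribution N" "F = cdf N" using assms by (auto simp: is_cdf_def)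
  interpret real_distribution N by fact
  show "mono F" using N cdf_nondecreasing by (auto simp: mono_def)
  show "continuous (at_right x) F" using N cdf_is_right_cont by simp
  show "(F \<longlongrightarrow> 1) at_top" using N cdf_lim_at_top_prob by simp
  show "(F \<longlongrightarrow> 0) at_bot" using N cdf_lim_at_bot by simp
  show "0 \<le> F x" "F x \<le> 1" using N cdf_nonneg cdf_bounded_prob by auto
qed

lemma Inf_level_set_le_iff:
  assumes F: "is_cdf F" and t: "0 < t" "t < 1"
  shows "Inf {u. t \<le> F u} \<le> x \<longleftrightarrow> t \<le> F x"
proof -
  note mono = is_cdf_mono[OF F, THEN monoD]
  define A where "A = {u. t \<le> F u}"
  have "\<forall>\<^sub>F u in at_top. t < F u" using order_tendstoD(1)[OF is_cdf_at_top[OF F] t(2)] .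
  then obtain u0 where "t < F u0" by (auto simp: eventually_at_top_linorder)
  then have ne: "A \<noteq> {}" by (auto simp: A_def intro: less_imp_le)
  have "\<forall>\<^sub>F u in at_bot. F u < t" using order_tendstoD(2)[OF is_cdf_at_bot[OF F] t(1)] .
  then obtain u1 where u1: "\<And>u. u \<le> u1 \<Longrightarrow> F u < t" by (auto simp: eventually_at_bot_linorder)
  have bdd: "bdd_below A"
  proof (rule bdd_belowI[of _ u1])
    fix u assume "u \<in> A"
    then show "u1 \<le> u" using u1[of u] by (cases "u \<le> u1") (auto simp: A_def)
  qed
  have "t \<le> F (Inf A)"
  proof (rule tendsto_lowerbound)
    show "(F \<longlongrightarrow> F (Inf A)) (at_right (Inf A))"
      using is_cdf_right_cont[OF F, of "Inf A"] by (simp add: continuous_within)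
    show "\<forall>\<^sub>F u in at_right (Inf A). t \<le> F u"
      using eventually_at_right_less[of "Inf A"]
    proof eventually_elim
      case (elim u)
      then obtain v where "v \<in> A" "v < u" using cInf_lessD[OF ne] by auto
      then show "t \<le> F u" using mono[of v u] by (auto simp: A_def)
    qed
  qed simp
  then show ?thesis
    using mono[of "Inf A" x] cInf_lower[OF _ bdd, of x] by (force simp: A_def)
qed

lemma quantile_le_iff:
  assumes F: "is_cdf F" and supp: "cdf_support F = {c..}" and t: "0 \<le> t" "t < 1" and x: "c \<le> x"
  shows "quantile F t \<le> x \<longleftrightarrow> t \<le> F x"
proof (cases "t = 0")
  case True
  then show ?thesis using x is_cdf_bounds(1)[OF F, of x] by (simp add: quantile_zero[OF supp])
next
  case False
  then show ?thesis using t Inf_level_set_le_iff[OF F, of t x] by (simp add: quantile_def)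
qed

text \<open>If \<open>0 < F x < 1\<close>, then the quantile of \<open>F x\<close> is a point of the support not exceeding \<open>x\<close>.\<close>

lemma cdf_eq_0_below_support:
  assumes F: "is_cdf F" and supp: "cdf_support F = {c..}" and x: "x < c"
  shows "F x = 0"
proof (rule ccontr)
  assume "F x \<noteq> 0"
  then have pos: "0 < F x" using is_cdf_bounds(1)[OF F, of x] by linarith
  note mono = is_cdf_mono[OF F, THEN monoD]
  have less1: "F x < 1"
  proof (rule ccontr)
    assume "\<not> F x < 1"
    then have 1: "F x = 1" using is_cdf_bounds(2)[OF F, of x] by linarith
    have "F u = 1" if "x \<le> u" for u
      using mono[OF that] 1 is_cdf_bounds(2)[OF F, of u] by linarith
    then have "F (c + 1 - (c + 1 - x)) = F (c + 1 + (c + 1 - x))" using x by simp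
    moreover have "c + 1 \<in> cdf_support F" using supp by simp
    ultimately show False using x by (auto simp: cdf_support_def dest: spec[of _ "c + 1 - x"])
  qed
  define v where "v = Inf {u. F x \<le> F u}"
  have iff: "v \<le> u \<longleftrightarrow> F x \<le> F u" for u
    unfolding v_def by (rule Inf_level_set_le_iff[OF F pos less1])
  have "v \<in> cdf_support F"
    unfolding cdf_support_def
  proof safe
    fix e :: real assume e: "0 < e"
    have "F (v - e) < F x" using iff[of "v - e"] e by auto
    also have "F x \<le> F (v + e)" using iff[of "v + e"] e by auto
    finally show "F (v - e) < F (v + e)" .
  qed
  moreover have "v \<le> x" using iff[of x] by simp
  ultimately show False using supp x by auto
qed

lemma quantile_ge_left_end:
  assumes F: "is_cdf F" and supp: "cdf_support F = {c..}" and t: "0 \<le> t" "t < 1"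
  shows "c \<le> quantile F t"
proof (cases "t = 0")
  case True
  then show ?thesis by (simp add: quantile_zero[OF supp])
next
  case False
  with t have t': "0 < t" by simp
  define v where "v = Inf {u. t \<le> F u}"
  have "\<not> v < c"
    using Inf_level_set_le_iff[OF F t' t(2), of v] cdf_eq_0_below_support[OF F supp, of v] t'
    by (auto simp: v_def)
  then show ?thesis using False by (simp add: quantile_def v_def)
qed

lemma quantile_ge_1:
  assumes F: "\<And>x. F x < 1" and t: "1 \<le> t"
  shows "quantile F t = Inf {}"
proof -
  have "{x. t \<le> F x} = {}" using F t by (auto simp: not_le intro: less_le_trans)
  with t show ?thesis by (simp add: quantile_def)
qed

lemma RV_star_properties:
  assumes "F \<in> RV_star \<gamma>"
  obtains c where "is_cdf F" "cdf_support F = {c..}" "continuous_on {c..} F" "strict_mono_on {c..} F"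
    "\<And>x. F x < 1"
    "\<And>y. 0 < y \<Longrightarrow> ((\<lambda>x. (1 - F (x * y)) / (1 - F x)) \<longlongrightarrow> y powr (- \<gamma>)) at_top"
proof -
  obtain c where c: "cdf_support F = {c..}" using assms by (auto simp: RV_star_def)
  have F: "is_cdf F" using assms by (simp add: RV_star_def RV_def)
  have sm: "strict_mono_on {c..} F" using assms c by (simp add: RV_star_def)
  have "F x < 1" for x
  proof -
    have "F x \<le> F (max x c)" using is_cdf_mono[OF F] by (simp add: monoD)
    also have "\<dots> < F (max x c + 1)" using sm by (auto simp: strict_mono_on_def)
    also have "\<dots> \<le> 1" by (rule is_cdf_bounds[OF F])
    finally show ?thesis .
  qed
  with that[OF F c _ sm] show ?thesis using assms c by (simp add: RV_star_def RV_def)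
qed

lemma tail_level_exists:
  assumes F: "is_cdf F" and cont: "continuous_on {c..} F" and b: "0 < b" "b < 1 - F c"
  shows "\<exists>t>c. 1 - F t = b"
proof -
  have "\<forall>\<^sub>F u in at_top. 1 - b < F u" using b order_tendstoD(1)[OF is_cdf_at_top[OF F], of "1 - b"] by simp
  then have "\<forall>\<^sub>F u in at_top. 1 - b < F u \<and> c < u"
    using eventually_gt_at_top by (rule eventually_conj)
  then obtain u where u: "1 - b < F u" "c < u" by (auto simp: eventually_at_top_linorder)
  have "\<exists>t\<ge>c. t \<le> u \<and> F t = 1 - b"
    by (rule IVT') (use u b cont in \<open>auto intro: continuous_on_subset\<close>)
  then obtain t where t: "c \<le> t" "F t = 1 - b" by blast
  with b have "t \<noteq> c" by auto
  with t show ?thesis by (intro exI[of _ t]) auto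
qed

section \<open>P-values with an MRV copula\<close>

lemma filterlim_mult_at_right:
  assumes "0 < (c::real)" shows "filterlim (\<lambda>s. c * s) (at_right 0) (at_right 0)"
proof -
  have "((\<lambda>s. c * s) \<longlongrightarrow> c * 0) (at_right 0)" by (intro tendsto_intros)
  moreover have "\<forall>\<^sub>F s in at_right 0. c * s \<in> {0<..}"
    using eventually_at_right_less[of 0] by eventually_elim (use assms in simp)
  ultimately show ?thesis
    unfolding filterlim_at by (auto elim!: eventually_mono)
qed

lemma exists_level_near_1:
  fixes f :: "real \<Rightarrow> real"
  assumes "a < f 1" "isCont f 1"
  shows "\<exists>h. 0 < h \<and> h < 1 \<and> a < f h" "\<exists>h>1. a < f h"
proof -
  have lim: "(f \<longlongrightarrow> f 1) (at 1)" using assms by (simp add: isCont_def)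
  have "\<forall>\<^sub>F h in at_left 1. a < f h"
    using tendsto_mono[OF at_le[of "{..<1}" UNIV] lim] assms(1) by (auto intro: order_tendstoD)
  then have "\<forall>\<^sub>F h in at_left 1. h \<in> {0<..<1} \<and> a < f h"
    using eventually_at_left_real[of 0 1] by (intro eventually_conj) auto
  then show "\<exists>h. 0 < h \<and> h < 1 \<and> a < f h"
    using eventually_happens'[OF trivial_limit_at_left_real] by fastforce
  have "\<forall>\<^sub>F h in at_right 1. a < f h"
    using tendsto_mono[OF at_le[of "{1<..}" UNIV] lim] assms(1) by (auto intro: order_tendstoD)
  then have "\<forall>\<^sub>F h in at_right 1. h \<in> {1<..<2} \<and> a < f h"
    using eventually_at_right_real[of 1 2] by (intro eventually_conj) auto
  then show "\<exists>h>1. a < f h"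
    using eventually_happens'[OF trivial_limit_at_right_real] by fastforce
qed

lemma sum_UNIV_option: "(\<Sum>j\<in>UNIV. f j) = f None + (\<Sum>j\<in>UNIV. f (Some j))"
  for f :: "'k::finite option \<Rightarrow> real"
  by (simp add: UNIV_option_conv sum.reindex)

text \<open>The distribution function of the uniform distribution on the unit interval.\<close>

definition clamp01 :: "real \<Rightarrow> real" where "clamp01 v = max 0 (min 1 v)"

lemma clamp01_lipschitz: "\<bar>clamp01 u - clamp01 v\<bar> \<le> \<bar>u - v\<bar>"
  unfolding clamp01_def by linarith

lemma clamp01_le: "0 \<le> v \<Longrightarrow> clamp01 v \<le> v"
  unfolding clamp01_def by linarith

text \<open>Uniform p-values, stated through \<open>P\<close> itself: \<open>copula_tail\<close> of the copula of \<open>1 - P\<close> at \<open>v\<close> is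
  the probability that some \<open>P i\<close> is less than \<open>v i\<close>. The function \<open>l\<close> is the limit in the
  definition of an MRV copula.\<close>

locale mrv_pvalues = prob_space M for M :: "'a measure" +
  fixes P :: "'n::finite \<Rightarrow> 'a \<Rightarrow> real" and w :: "'n \<Rightarrow> real" and l :: "('n \<Rightarrow> real) \<Rightarrow> real"
  assumes P_measurable [measurable]: "\<And>i. P i \<in> borel_measurable M"
    and w_pos: "\<And>i. 0 < w i"
    and w_sum: "(\<Sum>i\<in>UNIV. w i) = real CARD('n)"
    and uniform: "\<And>i v. prob {x \<in> space M. P i x < v} = clamp01 v"
    and tail_limit: "\<And>v. (\<And>i. 0 \<le> v i) \<Longrightarrow>
      ((\<lambda>s. prob {x \<in> space M. \<exists>i. P i x < s * v i} / s) \<longlongrightarrow> l v) (at_right 0)"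
begin

text \<open>The copula tail, defined on all of \<open>\<real>\<^sup>n\<close>.\<close>

definition D :: "('n \<Rightarrow> real) \<Rightarrow> real" where
  "D v = prob {x \<in> space M. \<exists>i. P i x < v i}"

lemma D_diff_le: "D u - D v \<le> (\<Sum>i\<in>UNIV. \<bar>clamp01 (u i) - clamp01 (v i)\<bar>)"
proof -
  let ?B = "\<lambda>i. {x \<in> space M. v i \<le> P i x \<and> P i x < u i}"
  have B: "prob (?B i) \<le> \<bar>clamp01 (u i) - clamp01 (v i)\<bar>" for i
  proof (cases "v i \<le> u i")
    case True
    have eq: "?B i = {x \<in> space M. P i x < u i} - {x \<in> space M. P i x < v i}" by auto
    have "prob (?B i) = prob {x \<in> space M. P i x < u i} - prob {x \<in> space M. P i x < v i}"
      unfolding eq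
    proof (rule finite_measure_Diff)
      show "{x \<in> space M. P i x < v i} \<subseteq> {x \<in> space M. P i x < u i}"
        using True by (auto intro: less_le_trans)
    qed measurable
    then show ?thesis by (simp add: uniform)
  next
    case False
    then have eq: "?B i = {}" by auto
    show ?thesis unfolding eq by simp
  qed
  have "D u \<le> prob ({x \<in> space M. \<exists>i. P i x < v i} \<union> (\<Union>i\<in>UNIV. ?B i))"
    unfolding D_def
  proof (rule finite_measure_mono)
    show "{x \<in> space M. \<exists>i. P i x < u i} \<subseteq> {x \<in> space M. \<exists>i. P i x < v i} \<union> (\<Union>i\<in>UNIV. ?B i)"
      using not_le by blast
  qed measurable
  also have "\<dots> \<le> D v + prob (\<Union>i\<in>UNIV. ?B i)"
    unfolding D_def by (rule measure_Un_le) auto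
  also have "prob (\<Union>i\<in>UNIV. ?B i) \<le> (\<Sum>i\<in>UNIV. prob (?B i))"
    by (rule finite_measure_subadditive_finite) auto
  also have "\<dots> \<le> (\<Sum>i\<in>UNIV. \<bar>clamp01 (u i) - clamp01 (v i)\<bar>)"
    by (intro sum_mono B)
  finally show ?thesis by simp
qed

lemma D_lipschitz: "\<bar>D u - D v\<bar> \<le> (\<Sum>i\<in>UNIV. \<bar>u i - v i\<bar>)"
proof -
  have "(\<Sum>i\<in>UNIV. \<bar>clamp01 (u i) - clamp01 (v i)\<bar>) \<le> (\<Sum>i\<in>UNIV. \<bar>u i - v i\<bar>)"
    by (intro sum_mono clamp01_lipschitz)
  moreover have "(\<Sum>i\<in>UNIV. \<bar>clamp01 (v i) - clamp01 (u i)\<bar>) \<le> (\<Sum>i\<in>UNIV. \<bar>u i - v i\<bar>)"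
    by (intro sum_mono) (metis clamp01_lipschitz abs_minus_commute)
  ultimately show ?thesis using D_diff_le[of u v] D_diff_le[of v u] by linarith
qed

text \<open>Since \<open>D\<close> is Lipschitz, the MRV limit may be taken along asymptotically linear paths.\<close>

lemma D_limit:
  assumes v: "\<And>i. 0 \<le> v i"
    and u: "\<And>i. ((\<lambda>s. u s i / s) \<longlongrightarrow> v i) (at_right 0)"
  shows "((\<lambda>s. D (u s) / s) \<longlongrightarrow> l v) (at_right 0)"
proof -
  have lim: "((\<lambda>s. D (\<lambda>i. s * v i) / s) \<longlongrightarrow> l v) (at_right 0)"
    using tail_limit[OF v] by (simp add: D_def)
  have "((\<lambda>s. D (u s) / s - D (\<lambda>i. s * v i) / s) \<longlongrightarrow> 0) (at_right 0)"
  proof (rule Lim_null_comparison)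
    show "((\<lambda>s. \<Sum>i\<in>UNIV. \<bar>u s i / s - v i\<bar>) \<longlongrightarrow> 0) (at_right 0)"
      by (intro tendsto_null_sum tendsto_rabs_zero LIM_zero u)
    show "\<forall>\<^sub>F s in at_right 0. norm (D (u s) / s - D (\<lambda>i. s * v i) / s) \<le> (\<Sum>i\<in>UNIV. \<bar>u s i / s - v i\<bar>)"
      using eventually_at_right_less[of 0]
    proof eventually_elim
      case (elim s)
      have "norm (D (u s) / s - D (\<lambda>i. s * v i) / s) = \<bar>D (u s) - D (\<lambda>i. s * v i)\<bar> / s"
        using elim by (simp add: diff_divide_distrib[symmetric])
      also have "\<dots> \<le> (\<Sum>i\<in>UNIV. \<bar>u s i - s * v i\<bar>) / s"
        using elim by (intro divide_right_mono D_lipschitz) simp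
      also have "\<dots> = (\<Sum>i\<in>UNIV. \<bar>u s i / s - v i\<bar>)"
        unfolding sum_divide_distrib
      proof (rule sum.cong)
        fix i
        have "u s i / s - v i = (u s i - s * v i) / s" using elim by (simp add: field_simps)
        then show "\<bar>u s i - s * v i\<bar> / s = \<bar>u s i / s - v i\<bar>" using elim by simp
      qed simp
      finally show ?case .
    qed
  qed
  from tendsto_add[OF this lim] show ?thesis by simp
qed

lemma l_bounds:
  assumes v: "\<And>i. 0 \<le> v i"
  shows l_nonneg: "0 \<le> l v" and l_le_sum: "l v \<le> (\<Sum>i\<in>UNIV. v i)"
proof -
  have lim: "((\<lambda>s. D (\<lambda>i. s * v i) / s) \<longlongrightarrow> l v) (at_right 0)"
    using tail_limit[OF v] by (simp add: D_def)
  show "0 \<le> l v"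
    by (rule tendsto_lowerbound[OF lim])
      (use eventually_at_right_less[of 0] in eventually_elim, auto simp: D_def)
  show "l v \<le> (\<Sum>i\<in>UNIV. v i)"
  proof (rule tendsto_upperbound[OF lim])
    show "\<forall>\<^sub>F s in at_right 0. D (\<lambda>i. s * v i) / s \<le> (\<Sum>i\<in>UNIV. v i)"
      using eventually_at_right_less[of 0]
    proof eventually_elim
      case (elim s)
      have "D (\<lambda>_. 0) \<le> (\<Sum>i\<in>(UNIV :: 'n set). prob {x \<in> space M. P i x < 0})"
      proof -
        have "{x \<in> space M. \<exists>i. P i x < 0} = (\<Union>i. {x \<in> space M. P i x < 0})" by auto
        then show ?thesis unfolding D_def
          by (simp only:) (rule finite_measure_subadditive_finite, auto)
      qed
      also have "\<dots> = 0" by (simp add: uniform clamp01_def)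
      finally have "D (\<lambda>_. 0) \<le> 0" .
      then have "D (\<lambda>i. s * v i) \<le> (\<Sum>i\<in>UNIV. s * v i)"
        using D_lipschitz[of "\<lambda>i. s * v i" "\<lambda>_. 0"] elim v by (simp add: abs_mult)
      then show ?case using elim by (simp add: sum_distrib_left[symmetric] field_simps)
    qed
  qed simp
qed

lemma AE_P_pos: "AE x in M. \<forall>i. 0 < P i x"
proof -
  have "AE x in M. 0 < P i x" for i
  proof -
    have "prob {x \<in> space M. P i x \<le> 0} \<le> 0"
    proof (rule field_le_epsilon)
      fix e :: real assume e: "0 < e"
      have "prob {x \<in> space M. P i x \<le> 0} \<le> prob {x \<in> space M. P i x < e}"
        by (rule finite_measure_mono) (use e in auto)
      also have "\<dots> \<le> e" using e by (simp add: uniform clamp01_le)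
      finally show "prob {x \<in> space M. P i x \<le> 0} \<le> 0 + e" by simp
    qed
    then have "prob {x \<in> space M. P i x \<le> 0} = 0" by (simp add: measure_le_0_iff)
    then have "emeasure M {x \<in> space M. P i x \<le> 0} = 0" by (simp add: emeasure_eq_measure)
    then show ?thesis by (subst AE_iff_measurable[OF _ refl]) (auto simp: not_less)
  qed
  then show ?thesis by (simp add: AE_all_countable)
qed

text \<open>The inverse p-values have tails \<open>Pr(Y i > z) = w i / z\<close> for large \<open>z\<close>. The value on the null
  event \<open>P i \<le> 0\<close> is irrelevant.\<close>

definition Y :: "'n \<Rightarrow> 'a \<Rightarrow> real" where
  "Y i x = (if 0 < P i x then w i / P i x else 0)"

lemma Y_measurable [measurable]: "Y i \<in> borel_measurable M"
  unfolding Y_def by measurable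

lemma Y_nonneg: "0 \<le> Y i x"
  using w_pos[of i] by (auto simp: Y_def)

lemma Y_tail:
  assumes "\<And>i. 0 \<le> c i" "\<And>i. 0 < z i"
  shows "prob {x \<in> space M. \<exists>i. z i < c i * Y i x} = D (\<lambda>i. c i * w i / z i)"
  unfolding D_def
proof (rule finite_measure_eq_AE)
  show "AE x in M. x \<in> {x \<in> space M. \<exists>i. z i < c i * Y i x} \<longleftrightarrow>
      x \<in> {x \<in> space M. \<exists>i. P i x < c i * w i / z i}"
    using AE_P_pos
  proof eventually_elim
    case (elim x)
    have "z i < c i * Y i x \<longleftrightarrow> P i x < c i * w i / z i" for i
      using elim assms(2)[of i] by (auto simp: Y_def field_simps)
    then show ?case by simp
  qed
qed measurable

lemma tail_const_Y: "tail_const (Y j) (w j)"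
proof -
  have "\<forall>\<^sub>F z in at_top. z * prob {x \<in> space M. z < Y j x} = w j"
    using eventually_gt_at_top[of 0] eventually_ge_at_top[of "w j"]
  proof eventually_elim
    case (elim z)
    have "prob {x \<in> space M. z < Y j x} = prob {x \<in> space M. P j x < w j / z}"
    proof (rule finite_measure_eq_AE)
      show "AE x in M. x \<in> {x \<in> space M. z < Y j x} \<longleftrightarrow> x \<in> {x \<in> space M. P j x < w j / z}"
        using AE_P_pos
      proof eventually_elim
        case (elim x)
        have "z < Y j x \<longleftrightarrow> P j x < w j / z"
          using elim \<open>0 < z\<close> by (auto simp: Y_def field_simps)
        then show ?case by simp
      qed
    qed measurable
    also have "\<dots> = w j / z"
      using elim w_pos[of j] by (simp add: uniform clamp01_def)
    finally show ?case using elim by simp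
  qed
  then show ?thesis
    by (auto simp: tail_const_def Y_nonneg intro: tendsto_eventually)
qed

lemma tail_const_wmax_Y:
  assumes c: "\<And>i. 0 \<le> c i"
  shows "tail_const (\<lambda>x. wmax c (\<lambda>i. Y i x)) (l (\<lambda>i. c i * w i))"
  unfolding tail_const_def
proof (intro conjI ballI)
  show "(\<lambda>x. wmax c (\<lambda>i. Y i x)) \<in> borel_measurable M"
    unfolding borel_measurable_iff_greater wmax_greater_iff by measurable
  show "0 \<le> wmax c (\<lambda>i. Y i x)" for x
  proof -
    have "0 \<le> c i * Y i x" for i using c Y_nonneg by simp
    then show ?thesis using le_wmax[of c _ "\<lambda>i. Y i x"] order_trans by blast
  qed
  have "((\<lambda>s. D (\<lambda>i. s * (c i * w i)) / s) \<longlongrightarrow> l (\<lambda>i. c i * w i)) (at_right 0)"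
    using tail_limit[of "\<lambda>i. c i * w i"] c w_pos by (simp add: D_def less_imp_le)
  then have "((\<lambda>z. D (\<lambda>i. inverse z * (c i * w i)) / inverse z) \<longlongrightarrow> l (\<lambda>i. c i * w i)) at_top"
    by (simp add: filterlim_at_right_to_top)
  then show "((\<lambda>z. z * prob {x \<in> space M. z < wmax c (\<lambda>i. Y i x)}) \<longlongrightarrow> l (\<lambda>i. c i * w i)) at_top"
  proof (rule Lim_transform_eventually)
    show "\<forall>\<^sub>F z in at_top. D (\<lambda>i. inverse z * (c i * w i)) / inverse z
        = z * prob {x \<in> space M. z < wmax c (\<lambda>i. Y i x)}"
      using eventually_gt_at_top[of 0]
    proof eventually_elim
      case (elim z)
      then show ?case
        using Y_tail[OF c, of "\<lambda>_. z"] by (simp add: wmax_greater_iff field_simps)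
    qed
  qed
qed

section \<open>The limiting scaled type-I error\<close>

text \<open>The family that belongs to the Pareto distribution of index \<open>\<gamma>\<close>. It serves as a reference because
  its sums scale exactly in \<open>s\<close> (lemma \<open>pareto_level\<close>).\<close>

definition pareto :: "real \<Rightarrow> real \<Rightarrow> 'n \<Rightarrow> 'a \<Rightarrow> real" where
  "pareto \<gamma> s i x = (s * Y i x / real CARD('n)) powr (1 / \<gamma>)"

text \<open>The tail function shared by the families arising from all distributions of tail index \<open>\<gamma>\<close>.\<close>

definition L :: "real \<Rightarrow> ('n \<Rightarrow> real) \<Rightarrow> real" where
  "L \<gamma> y = l (\<lambda>i. w i * y i powr (- \<gamma>) / real CARD('n))"

lemma L_tendsto_0:
  assumes "0 < \<gamma>" shows "((\<lambda>m. L \<gamma> (\<lambda>_. m)) \<longlongrightarrow> 0) at_top"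
proof (rule tendsto_sandwich)
  have w: "0 \<le> w i * m powr (- \<gamma>) / real CARD('n)" for i m
    using w_pos[of i] by simp
  show "\<forall>\<^sub>F m in at_top. 0 \<le> L \<gamma> (\<lambda>_. m)"
    unfolding L_def by (intro always_eventually allI l_nonneg w)
  show "\<forall>\<^sub>F m in at_top. L \<gamma> (\<lambda>_. m) \<le> (\<Sum>i\<in>UNIV. w i * m powr (- \<gamma>) / real CARD('n))"
    unfolding L_def by (intro always_eventually allI l_le_sum w)
  have "((\<lambda>m. m powr (- \<gamma>)) \<longlongrightarrow> 0) at_top"
    using assms by (intro tendsto_neg_powr filterlim_ident) auto
  then show "((\<lambda>m. \<Sum>i\<in>UNIV. w i * m powr (- \<gamma>) / real CARD('n)) \<longlongrightarrow> 0) at_top"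
    by (intro tendsto_null_sum tendsto_divide_zero tendsto_mult_right_zero)
qed simp

lemma tail_function_R:
  assumes g: "0 < \<gamma>" shows "tail_function (pareto \<gamma>) (L \<gamma>)"
  unfolding tail_function_def
proof (intro conjI allI impI)
  show "pareto \<gamma> t i \<in> borel_measurable M" for t i
    unfolding pareto_def by measurable
  fix e :: real assume "0 < e"
  then have "- e \<le> pareto \<gamma> s i x" for s i x
    unfolding pareto_def using powr_ge_zero[of "s * Y i x / real CARD('n)" "1 / \<gamma>"] by linarith
  then show "\<forall>\<^sub>F t in at_right 0. \<forall>x\<in>space M. \<forall>i. - e \<le> pareto \<gamma> t i x" by simp
next
  fix y :: "'n \<Rightarrow> real" assume y: "\<forall>i. 0 < y i"
  have "((\<lambda>s. D (\<lambda>i. s * (w i * y i powr (- \<gamma>) / real CARD('n))) / s) \<longlongrightarrow> L \<gamma> y) (at_right 0)"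
    using tail_limit[of "\<lambda>i. w i * y i powr (- \<gamma>) / real CARD('n)"] w_pos
    by (simp add: D_def L_def less_imp_le)
  then show "((\<lambda>t. prob {x \<in> space M. \<exists>i. y i < pareto \<gamma> t i x} / t) \<longlongrightarrow> L \<gamma> y) (at_right 0)"
  proof (rule Lim_transform_eventually)
    show "\<forall>\<^sub>F s in at_right 0. D (\<lambda>i. s * (w i * y i powr (- \<gamma>) / real CARD('n))) / s
        = prob {x \<in> space M. \<exists>i. y i < pareto \<gamma> s i x} / s"
      using eventually_at_right_less[of 0]
    proof eventually_elim
      case (elim s)
      have iff: "y i < pareto \<gamma> s i x \<longleftrightarrow> real CARD('n) * y i powr \<gamma> / s < 1 * Y i x" for i x
      proof -
        have yi: "0 < y i" using y by simp
        have "y i < pareto \<gamma> s i x \<longleftrightarrow> (y i powr \<gamma>) powr (1 / \<gamma>) < (s * Y i x / real CARD('n)) powr (1 / \<gamma>)"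
          using yi g by (simp add: pareto_def powr_powr)
        also have "\<dots> \<longleftrightarrow> y i powr \<gamma> < s * Y i x / real CARD('n)"
        proof
          assume "y i powr \<gamma> < s * Y i x / real CARD('n)"
          then show "(y i powr \<gamma>) powr (1 / \<gamma>) < (s * Y i x / real CARD('n)) powr (1 / \<gamma>)"
            using g by (intro powr_less_mono2) auto
        next
          assume a: "(y i powr \<gamma>) powr (1 / \<gamma>) < (s * Y i x / real CARD('n)) powr (1 / \<gamma>)"
          show "y i powr \<gamma> < s * Y i x / real CARD('n)"
          proof (rule ccontr)
            assume "\<not> y i powr \<gamma> < s * Y i x / real CARD('n)"
            then have "(s * Y i x / real CARD('n)) powr (1 / \<gamma>) \<le> (y i powr \<gamma>) powr (1 / \<gamma>)"
              using g elim Y_nonneg[of i x] by (intro powr_mono2) auto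
            with a show False by simp
          qed
        qed
        also have "\<dots> \<longleftrightarrow> real CARD('n) * y i powr \<gamma> / s < 1 * Y i x"
          using elim by (simp add: field_simps)
        finally show ?thesis .
      qed
      have "prob {x \<in> space M. \<exists>i. y i < pareto \<gamma> s i x} = D (\<lambda>i. 1 * w i / (real CARD('n) * y i powr \<gamma> / s))"
        unfolding iff using elim y by (intro Y_tail) (auto simp: less_imp_neq[THEN not_sym])
      also have "(\<lambda>i. 1 * w i / (real CARD('n) * y i powr \<gamma> / s)) = (\<lambda>i. s * (w i * y i powr (- \<gamma>) / real CARD('n)))"
        by (rule ext) (simp add: powr_minus field_simps)
      finally show ?case by simp
    qed
  qed
qed

lemma pareto_level:
  assumes "0 < \<gamma>" "0 < h" "0 < s"
  shows "prob {x \<in> space M. h < (\<Sum>i\<in>UNIV. pareto \<gamma> s i x)}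
       = prob {x \<in> space M. 1 < (\<Sum>i\<in>UNIV. pareto \<gamma> (h powr (- \<gamma>) * s) i x)}"
proof -
  have "pareto \<gamma> (h powr (- \<gamma>) * s) i x = pareto \<gamma> s i x / h" for i x
  proof -
    have "pareto \<gamma> (h powr (- \<gamma>) * s) i x = (h powr (- \<gamma>) * (s * Y i x / real CARD('n))) powr (1 / \<gamma>)"
      by (simp add: pareto_def mult.assoc)
    also have "\<dots> = (h powr (- \<gamma>)) powr (1 / \<gamma>) * pareto \<gamma> s i x"
      using assms Y_nonneg[of i x] by (subst powr_mult) (auto simp: pareto_def)
    also have "(h powr (- \<gamma>)) powr (1 / \<gamma>) = h powr (- 1)"
      using assms by (simp add: powr_powr)
    also have "\<dots> = inverse h" using assms by (simp add: powr_minus)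
    finally show ?thesis by (simp add: divide_inverse mult.commute)
  qed
  then show ?thesis
    using assms by (simp add: sum_divide_distrib[symmetric] less_divide_eq)
qed

lemma pareto_level_limit:
  assumes g: "0 < \<gamma>" and h: "0 < h"
    and q: "((\<lambda>s. prob {x \<in> space M. 1 < (\<Sum>i\<in>UNIV. pareto \<gamma> s i x)} / s) \<longlongrightarrow> q) (at_right 0)"
  shows "((\<lambda>s. prob {x \<in> space M. h < (\<Sum>i\<in>UNIV. pareto \<gamma> s i x)} / s) \<longlongrightarrow> h powr (- \<gamma>) * q) (at_right 0)"
proof -
  let ?k = "h powr (- \<gamma>)"
  have k: "0 < ?k" using h by simp
  have "((\<lambda>s. ?k * (prob {x \<in> space M. 1 < (\<Sum>i\<in>UNIV. pareto \<gamma> (?k * s) i x)} / (?k * s))) \<longlongrightarrow> ?k * q) (at_right 0)"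
    by (intro tendsto_mult_left filterlim_compose[OF q] filterlim_mult_at_right k)
  then show ?thesis
  proof (rule Lim_transform_eventually)
    show "\<forall>\<^sub>F s in at_right 0. ?k * (prob {x \<in> space M. 1 < (\<Sum>i\<in>UNIV. pareto \<gamma> (?k * s) i x)} / (?k * s))
       = prob {x \<in> space M. h < (\<Sum>i\<in>UNIV. pareto \<gamma> s i x)} / s"
      using eventually_at_right_less[of 0]
    proof eventually_elim
      case (elim s)
      show ?case unfolding pareto_level[OF g h elim] using k by (simp only: times_divide_eq_right) simp
    qed
  qed
qed

text \<open>Comparing the family with itself at the levels 1 and \<open>h < 1\<close> shows, by scaling, that the upper
  limit is at most \<open>h powr (- \<gamma>)\<close> times the lower limit, up to a small error.\<close>

lemma pareto_limit_exists:
  assumes g: "0 < \<gamma>"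
  shows "\<exists>q. ((\<lambda>s. prob {x \<in> space M. 1 < (\<Sum>i\<in>UNIV. pareto \<gamma> s i x)} / s) \<longlongrightarrow> q) (at_right 0)"
proof -
  define a where "a s = prob {x \<in> space M. 1 < (\<Sum>i\<in>UNIV. pareto \<gamma> s i x)} / s" for s
  have pareto_meas [measurable]: "pareto \<gamma> s i \<in> borel_measurable M" for s i
    using tail_function_R[OF g] by (simp add: tail_function_def)
  have cmp: "\<exists>B. (\<forall>\<^sub>F s in at_right 0. a s \<le> B) \<and> (\<forall>\<^sub>F s in at_right 0. B \<le> h powr (- \<gamma>) * a s + e)"
    if h: "0 < h" "h < 1" and e: "0 < e" for h e
  proof -
    obtain B where B: "\<forall>\<^sub>F s in at_right 0. prob {x \<in> space M. 1 \<le> (\<Sum>i\<in>UNIV. pareto \<gamma> s i x)} / s \<le> B"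
      "\<forall>\<^sub>F s in at_right 0. B \<le> prob {x \<in> space M. h < (\<Sum>i\<in>UNIV. pareto \<gamma> s i x)} / s + e"
      using tail_function_compare[OF tail_function_R[OF g] tail_function_R[OF g] L_tendsto_0[OF g] h e] by blast
    have 1: "\<forall>\<^sub>F s in at_right 0. a s \<le> B"
      using B(1) eventually_at_right_less[of 0]
    proof eventually_elim
      case (elim s)
      have "a s \<le> prob {x \<in> space M. 1 \<le> (\<Sum>i\<in>UNIV. pareto \<gamma> s i x)} / s"
        unfolding a_def using elim by (intro divide_right_mono finite_measure_mono) auto
      with elim show ?case by simp
    qed
    let ?k = "h powr \<gamma>"
    have k: "0 < ?k" "h powr (- \<gamma>) * ?k = 1" using h by (simp_all add: powr_minus)
    have "\<forall>\<^sub>F s in at_right 0. B \<le> prob {x \<in> space M. h < (\<Sum>i\<in>UNIV. pareto \<gamma> (?k * s) i x)} / (?k * s) + e"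
      by (rule eventually_compose_filterlim[OF B(2) filterlim_mult_at_right[OF k(1)]])
    then have 2: "\<forall>\<^sub>F s in at_right 0. B \<le> h powr (- \<gamma>) * a s + e"
      using eventually_at_right_less[of 0]
    proof eventually_elim
      case (elim s)
      have "prob {x \<in> space M. h < (\<Sum>i\<in>UNIV. pareto \<gamma> (?k * s) i x)}
          = prob {x \<in> space M. 1 < (\<Sum>i\<in>UNIV. pareto \<gamma> s i x)}"
        using pareto_level[OF g h(1), of "?k * s"] k elim by (simp add: mult.assoc[symmetric])
      with elim k(1) h show ?case by (simp add: a_def powr_minus field_simps)
    qed
    from 1 2 show ?thesis by blast
  qed
  \<comment> \<open>The infimum of the eventual upper bounds is the upper limit.\<close>
  define S where "S = {B. \<forall>\<^sub>F s in at_right 0. a s \<le> B}"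
  have ne: "S \<noteq> {}" using cmp[of "1/2" 1] by (auto simp: S_def)
  have S0: "0 \<le> B" if "B \<in> S" for B
  proof -
    have "\<forall>\<^sub>F s in at_right (0::real). 0 \<le> B"
      using that[unfolded S_def mem_Collect_eq] eventually_at_right_less[of 0]
    proof eventually_elim
      case (elim s)
      have "0 \<le> a s" using elim by (simp add: a_def)
      with elim show ?case by simp
    qed
    then show ?thesis by simp
  qed
  then have bdd: "bdd_below S" by (intro bdd_belowI[of _ 0])
  define q where "q = Inf S"
  have "(a \<longlongrightarrow> q) (at_right 0)"
  proof (rule order_tendstoI)
    fix u assume "q < u"
    then obtain B where B: "B \<in> S" "B < u" using cInf_lessD[OF ne] by (auto simp: q_def)
    then show "\<forall>\<^sub>F s in at_right 0. a s < u"
      unfolding S_def by (auto elim: eventually_mono)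
  next
    fix u assume u: "u < q"
    define e where "e = (q - u) / 2"
    have e: "0 < e" "u < q - e" using u by (auto simp: e_def field_simps)
    obtain h where h: "0 < h" "h < 1" "u < h powr \<gamma> * (q - e)"
    proof -
      have "isCont (\<lambda>h. h powr \<gamma> * (q - e)) 1" by (intro continuous_intros) simp_all
      from exists_level_near_1(1)[of u "\<lambda>h. h powr \<gamma> * (q - e)", OF _ this] e that show ?thesis by auto
    qed
    obtain B where B: "\<forall>\<^sub>F s in at_right 0. a s \<le> B" "\<forall>\<^sub>F s in at_right 0. B \<le> h powr (- \<gamma>) * a s + e"
      using cmp[OF h(1,2) e(1)] by blast
    have "q \<le> B" unfolding q_def by (rule cInf_lower[OF _ bdd]) (simp add: S_def B)
    from B(2) show "\<forall>\<^sub>F s in at_right 0. u < a s"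
    proof eventually_elim
      case (elim s)
      then have "q - e \<le> h powr (- \<gamma>) * a s" using \<open>q \<le> B\<close> by simp
      then have "h powr \<gamma> * (q - e) \<le> h powr \<gamma> * (h powr (- \<gamma>) * a s)"
        by (intro mult_left_mono) auto
      also have "\<dots> = a s" using h by (simp add: powr_minus)
      finally show ?case using h by simp
    qed
  qed
  then show ?thesis unfolding a_def by blast
qed

text \<open>The scaled type-I error as a function of the tail index.\<close>

definition q :: "real \<Rightarrow> real" where
  "q \<gamma> = (SOME q. ((\<lambda>s. prob {x \<in> space M. 1 < (\<Sum>i\<in>UNIV. pareto \<gamma> s i x)} / s) \<longlongrightarrow> q) (at_right 0))"

lemma pareto_limit:
  "0 < \<gamma> \<Longrightarrow> ((\<lambda>s. prob {x \<in> space M. 1 < (\<Sum>i\<in>UNIV. pareto \<gamma> s i x)} / s) \<longlongrightarrow> q \<gamma>) (at_right 0)"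
  unfolding q_def by (rule someI_ex) (rule pareto_limit_exists)

text \<open>The threshold probabilities of the sum depend on the family only through its tail function.\<close>

lemma tail_function_limit:
  assumes g: "0 < \<gamma>" and T: "tail_function T (L \<gamma>)"
  shows "((\<lambda>t. prob {x \<in> space M. 1 \<le> (\<Sum>i\<in>UNIV. T t i x)} / t) \<longlongrightarrow> q \<gamma>) (at_right 0)"
proof (rule order_tendstoI)
  let ?p = "\<lambda>t. prob {x \<in> space M. 1 \<le> (\<Sum>i\<in>UNIV. T t i x)} / t"
  have T_meas [measurable]: "T t i \<in> borel_measurable M" for t i
    using T by (simp add: tail_function_def)
  have pareto_meas [measurable]: "pareto \<gamma> s i \<in> borel_measurable M" for s i
    using tail_function_R[OF g] by (simp add: tail_function_def)
  have cont: "isCont (\<lambda>h. k * h powr (- \<gamma>) + e) 1" for k e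
    by (intro continuous_intros) simp_all
  {
    fix u assume u: "q \<gamma> < u"
    define e where "e = (u - q \<gamma>) / 2"
    have e: "0 < e" "q \<gamma> + e < u" using u by (auto simp: e_def field_simps)
    obtain h where h: "0 < h" "h < 1" "h powr (- \<gamma>) * q \<gamma> + e < u"
      using exists_level_near_1(1)[OF _ cont[of "- q \<gamma>" "- e"], of "- u"] e by (auto simp: algebra_simps)
    obtain B where B: "\<forall>\<^sub>F t in at_right 0. ?p t \<le> B"
      "\<forall>\<^sub>F s in at_right 0. B \<le> prob {x \<in> space M. h < (\<Sum>i\<in>UNIV. pareto \<gamma> s i x)} / s + e"
      using tail_function_compare[OF T tail_function_R[OF g] L_tendsto_0[OF g] h(1,2) e(1)] by blast
    have "B \<le> h powr (- \<gamma>) * q \<gamma> + e"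
      by (rule tendsto_lowerbound[OF tendsto_add[OF pareto_level_limit[OF g h(1) pareto_limit[OF g]] tendsto_const] B(2)]) simp
    with h have "B < u" by simp
    with B(1) show "\<forall>\<^sub>F t in at_right 0. ?p t < u" by (auto elim: eventually_mono)
  next
    fix u assume u: "u < q \<gamma>"
    define e where "e = (q \<gamma> - u) / 2"
    have e: "0 < e" "u < q \<gamma> - e" using u by (auto simp: e_def field_simps)
    obtain h where h: "1 < h" "u < h powr (- \<gamma>) * q \<gamma> - e"
      using exists_level_near_1(2)[OF _ cont[of "q \<gamma>" "- e"], of u] e by (auto simp: algebra_simps)
    obtain B where B: "\<forall>\<^sub>F s in at_right 0. prob {x \<in> space M. h \<le> (\<Sum>i\<in>UNIV. pareto \<gamma> s i x)} / s \<le> B"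
      "\<forall>\<^sub>F t in at_right 0. B \<le> prob {x \<in> space M. 1 < (\<Sum>i\<in>UNIV. T t i x)} / t + e"
      using tail_function_compare[OF tail_function_R[OF g] T L_tendsto_0[OF g] _ h(1) e(1)] by auto
    have "h powr (- \<gamma>) * q \<gamma> \<le> B"
    proof (rule tendsto_upperbound[OF pareto_level_limit[OF g _ pareto_limit[OF g]]])
      show "\<forall>\<^sub>F s in at_right 0. prob {x \<in> space M. h < (\<Sum>i\<in>UNIV. pareto \<gamma> s i x)} / s \<le> B"
        using B(1) eventually_at_right_less[of 0]
      proof eventually_elim
        case (elim s)
        have "prob {x \<in> space M. h < (\<Sum>i\<in>UNIV. pareto \<gamma> s i x)} / s
            \<le> prob {x \<in> space M. h \<le> (\<Sum>i\<in>UNIV. pareto \<gamma> s i x)} / s"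
          using elim by (intro divide_right_mono finite_measure_mono) auto
        with elim show ?case by simp
      qed
    qed (use h in auto)
    with h have "u < B - e" by simp
    show "\<forall>\<^sub>F t in at_right 0. u < ?p t"
      using B(2) eventually_at_right_less[of 0]
    proof eventually_elim
      case (elim t)
      have "prob {x \<in> space M. 1 < (\<Sum>i\<in>UNIV. T t i x)} / t \<le> ?p t"
        using elim by (intro divide_right_mono finite_measure_mono) auto
      with elim \<open>u < B - e\<close> show ?case by simp
    qed
  }
qed

end

context mrv_pvalues
begin

text \<open>For small \<open>\<alpha>\<close> and the point \<open>t\<close> where \<open>1 - F t = \<alpha> * n powr (\<gamma> - 1)\<close>, the combined p-value
  is, up to a null event, at most \<open>\<alpha>\<close> precisely when the sum of the transformed p-values is at least
  \<open>n * t\<close>. The transformed p-values divided by \<open>n * t\<close> form a family with tail function \<open>L \<gamma>\<close>.\<close>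

lemma comb_pvalue_limit:
  assumes g: "0 < \<gamma>" and F: "F \<in> RV_star \<gamma>"
  shows "((\<lambda>\<alpha>. prob {x \<in> space M. comb_pvalue \<gamma> F w (\<lambda>i. P i x) \<le> \<alpha>} / \<alpha>) \<longlongrightarrow> q \<gamma>) (at_right 0)"
proof -
  let ?n = "real CARD('n)"
  obtain c where cdf: "is_cdf F" and supp: "cdf_support F = {c..}" and cont: "continuous_on {c..} F"
    and smono: "strict_mono_on {c..} F" and F1: "\<And>x. F x < 1"
    and rv: "\<And>y. 0 < y \<Longrightarrow> ((\<lambda>x. (1 - F (x * y)) / (1 - F x)) \<longlongrightarrow> y powr (- \<gamma>)) at_top"
    using RV_star_properties[OF F] by blast
  note mono = is_cdf_mono[OF cdf, THEN monoD]
  \<comment> \<open>The value on the null event \<open>P i x \<le> 0\<close> is set to \<open>c\<close>, which makes \<open>X\<close> bounded below.\<close>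
  define X where "X i x = (if 0 < P i x then quantile F (max 0 (1 - P i x / w i)) else c)" for i x
  have X_ge: "c \<le> X i x" for i x
    using quantile_ge_left_end[OF cdf supp] w_pos[of i] by (auto simp: X_def)
  have X_le: "X i x \<le> a \<longleftrightarrow> P i x \<le> 0 \<or> 1 - P i x / w i \<le> F a" if a: "c \<le> a" for i x a
  proof (cases "0 < P i x")
    case True
    then have "max 0 (1 - P i x / w i) < 1" using w_pos[of i] by simp
    then have "X i x \<le> a \<longleftrightarrow> max 0 (1 - P i x / w i) \<le> F a"
      using quantile_le_iff[OF cdf supp _ _ a] True by (simp add: X_def)
    then show ?thesis using True is_cdf_bounds(1)[OF cdf, of a] by auto
  next
    case False
    then show ?thesis using a by (simp add: X_def)
  qed
  have X_meas [measurable]: "X i \<in> borel_measurable M" for i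
    unfolding borel_measurable_iff_le
  proof
    fix a
    show "{x \<in> space M. X i x \<le> a} \<in> sets M"
    proof (cases "c \<le> a")
      case True
      show ?thesis unfolding X_le[OF True] by measurable
    next
      case False
      then have "{x \<in> space M. X i x \<le> a} = {}" using X_ge[of i] by (auto dest: order_trans)
      then show ?thesis by (simp only: sets.empty_sets)
    qed
  qed
  define t where "t \<alpha> = (SOME t. c < t \<and> 1 - F t = \<alpha> * ?n powr (\<gamma> - 1))" for \<alpha>
  have k: "0 < ?n powr (\<gamma> - 1)" by simp
  have pos: "\<forall>\<^sub>F \<alpha>::real in at_right 0. 0 < \<alpha>" by (rule eventually_at_right_less)
  have small: "\<forall>\<^sub>F \<alpha>::real in at_right 0. \<alpha> * ?n powr (\<gamma> - 1) < b" if b: "0 < b" for b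
  proof (rule order_tendstoD(2)[OF _ b])
    have "((\<lambda>\<alpha>. \<alpha> * ?n powr (\<gamma> - 1)) \<longlongrightarrow> 0 * ?n powr (\<gamma> - 1)) (at_right 0)"
      by (intro tendsto_intros)
    then show "((\<lambda>\<alpha>. \<alpha> * ?n powr (\<gamma> - 1)) \<longlongrightarrow> 0) (at_right 0)" by simp
  qed
  have Fc: "0 < 1 - F c" using F1[of c] by simp
  have t: "\<forall>\<^sub>F \<alpha> in at_right 0. c < t \<alpha> \<and> 1 - F (t \<alpha>) = \<alpha> * ?n powr (\<gamma> - 1)"
    using pos small[OF Fc]
  proof eventually_elim
    case (elim \<alpha>)
    have "\<exists>t>c. 1 - F t = \<alpha> * ?n powr (\<gamma> - 1)"
      using elim k by (intro tail_level_exists[OF cdf cont]) auto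
    then show ?case unfolding t_def by (rule someI_ex)
  qed
  have t_top: "filterlim t at_top (at_right 0)"
    unfolding filterlim_at_top
  proof
    fix K
    have "0 < 1 - F K" using F1[of K] by simp
    from t small[OF this] show "\<forall>\<^sub>F \<alpha> in at_right 0. K \<le> t \<alpha>"
    proof eventually_elim
      case (elim \<alpha>)
      then have "F K < F (t \<alpha>)" by simp
      then show ?case using mono[of "t \<alpha>" K] by (cases "K \<le> t \<alpha>") auto
    qed
  qed
  define T where "T \<alpha> i x = X i x / (?n * t \<alpha>)" for \<alpha> i x
  have T: "tail_function T (L \<gamma>)"
    unfolding tail_function_def
  proof (intro conjI allI impI)
    show "T \<alpha> i \<in> borel_measurable M" for \<alpha> i
      unfolding T_def by measurable
    fix e :: real assume e: "0 < e"
    have "((\<lambda>\<alpha>. c / (?n * t \<alpha>)) \<longlongrightarrow> 0) (at_right 0)"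
      by (intro tendsto_divide_0[OF tendsto_const] filterlim_at_top_imp_at_infinity
          filterlim_tendsto_pos_mult_at_top[OF tendsto_const _ t_top]) simp
    then have "\<forall>\<^sub>F \<alpha> in at_right 0. - e < c / (?n * t \<alpha>)"
      using e by (intro order_tendstoD(1)) auto
    moreover have "\<forall>\<^sub>F \<alpha> in at_right 0. 0 < t \<alpha>"
      using t_top by (auto simp: filterlim_at_top_dense)
    ultimately show "\<forall>\<^sub>F \<alpha> in at_right 0. \<forall>x\<in>space M. \<forall>i. - e \<le> T \<alpha> i x"
    proof eventually_elim
      case (elim \<alpha>)
      have "c / (?n * t \<alpha>) \<le> T \<alpha> i x" for i x
        unfolding T_def using elim X_ge by (intro divide_right_mono) auto
      with elim show ?case by (meson less_le_trans less_imp_le)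
    qed
  next
    fix y :: "'n \<Rightarrow> real" assume y: "\<forall>i. 0 < y i"
    have "((\<lambda>\<alpha>. D (\<lambda>i. w i * (1 - F (t \<alpha> * (?n * y i)))) / \<alpha>) \<longlongrightarrow> L \<gamma> y) (at_right 0)"
      unfolding L_def
    proof (rule D_limit)
      show "0 \<le> w i * y i powr - \<gamma> / ?n" for i using w_pos[of i] by simp
      fix i
      have yi: "0 < ?n * y i" using y by simp
      have "((\<lambda>\<alpha>. w i * (?n powr (\<gamma> - 1) * ((1 - F (t \<alpha> * (?n * y i))) / (1 - F (t \<alpha>)))))
          \<longlongrightarrow> w i * (?n powr (\<gamma> - 1) * (?n * y i) powr (- \<gamma>))) (at_right 0)"
        by (intro tendsto_mult_left filterlim_compose[OF rv[OF yi] t_top])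
      also have "w i * (?n powr (\<gamma> - 1) * (?n * y i) powr (- \<gamma>)) = w i * y i powr - \<gamma> / ?n"
      proof -
        have "(?n * y i) powr (- \<gamma>) = ?n powr (- \<gamma>) * y i powr (- \<gamma>)"
          using y by (simp add: powr_mult less_imp_le)
        moreover have "?n powr (\<gamma> - 1) * ?n powr (- \<gamma>) = ?n powr (- 1)"
          unfolding powr_add[symmetric] by simp
        moreover have "?n powr (- 1) = 1 / ?n"
          by (simp add: powr_minus divide_inverse)
        ultimately show ?thesis by (metis (no_types, lifting) mult.assoc mult.left_commute mult_1 times_divide_eq_left)
      qed
      finally show "((\<lambda>\<alpha>. w i * (1 - F (t \<alpha> * (?n * y i))) / \<alpha>) \<longlongrightarrow> w i * y i powr - \<gamma> / ?n) (at_right 0)"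
      proof (rule Lim_transform_eventually)
        show "\<forall>\<^sub>F \<alpha> in at_right 0. w i * (?n powr (\<gamma> - 1) * ((1 - F (t \<alpha> * (?n * y i))) / (1 - F (t \<alpha>))))
            = w i * (1 - F (t \<alpha> * (?n * y i))) / \<alpha>"
          using t pos
        proof eventually_elim
          case (elim \<alpha>)
          then have eq: "1 - F (t \<alpha>) = \<alpha> * ?n powr (\<gamma> - 1)" by simp
          show ?case unfolding eq using elim k by simp
        qed
      qed
    qed
    then show "((\<lambda>\<alpha>. prob {x \<in> space M. \<exists>i. y i < T \<alpha> i x} / \<alpha>) \<longlongrightarrow> L \<gamma> y) (at_right 0)"
    proof (rule Lim_transform_eventually)
      have "\<forall>\<^sub>F \<alpha> in at_right 0. \<forall>i. c \<le> t \<alpha> * (?n * y i)"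
      proof (rule eventually_all_finite)
        fix i
        have "filterlim (\<lambda>\<alpha>. t \<alpha> * (?n * y i)) at_top (at_right 0)"
          using y by (intro filterlim_at_top_mult_tendsto_pos[OF tendsto_const _ t_top]) auto
        then show "\<forall>\<^sub>F \<alpha> in at_right 0. c \<le> t \<alpha> * (?n * y i)" by (simp add: filterlim_at_top)
      qed
      moreover have "\<forall>\<^sub>F \<alpha> in at_right 0. 0 < t \<alpha>"
        using t_top by (auto simp: filterlim_at_top_dense)
      ultimately show "\<forall>\<^sub>F \<alpha> in at_right 0. D (\<lambda>i. w i * (1 - F (t \<alpha> * (?n * y i)))) / \<alpha>
          = prob {x \<in> space M. \<exists>i. y i < T \<alpha> i x} / \<alpha>"
      proof eventually_elim
        case (elim \<alpha>)
        have "D (\<lambda>i. w i * (1 - F (t \<alpha> * (?n * y i)))) = prob {x \<in> space M. \<exists>i. y i < T \<alpha> i x}"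
          unfolding D_def
        proof (rule finite_measure_eq_AE)
          show "AE x in M. x \<in> {x \<in> space M. \<exists>i. P i x < w i * (1 - F (t \<alpha> * (?n * y i)))}
             \<longleftrightarrow> x \<in> {x \<in> space M. \<exists>i. y i < T \<alpha> i x}"
            using AE_P_pos
          proof eventually_elim
            case (elim x)
            have "y i < T \<alpha> i x \<longleftrightarrow> P i x < w i * (1 - F (t \<alpha> * (?n * y i)))" for i
            proof -
              have "y i < T \<alpha> i x \<longleftrightarrow> \<not> X i x \<le> t \<alpha> * (?n * y i)"
                using \<open>0 < t \<alpha>\<close> by (simp add: T_def less_divide_eq not_le mult_ac)
              also have "\<dots> \<longleftrightarrow> \<not> 1 - P i x / w i \<le> F (t \<alpha> * (?n * y i))"
                using X_le[of "t \<alpha> * (?n * y i)" i x] \<open>\<forall>i. c \<le> t \<alpha> * (?n * y i)\<close> elim by (simp add: not_le)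
              also have "\<dots> \<longleftrightarrow> P i x < w i * (1 - F (t \<alpha> * (?n * y i)))"
                using w_pos[of i] by (simp add: field_simps not_le)
              finally show ?thesis .
            qed
            then show ?case by simp
          qed
        next
          show "{x \<in> space M. \<exists>i. y i < T \<alpha> i x} \<in> sets M"
            unfolding T_def by measurable
        qed measurable
        then show ?case by simp
      qed
    qed
  qed
  \<comment> \<open>For \<open>P i x \<le> 0\<close> the quantile takes its default value, the infimum of the empty set.\<close>
  have comb_meas: "{x \<in> space M. comb_pvalue \<gamma> F w (\<lambda>i. P i x) \<le> \<alpha>} \<in> sets M" for \<alpha>
  proof -
    have eq: "quantile F (max 0 (1 - P i x / w i)) = (if 0 < P i x then X i x else Inf {})" for i x
    proof (cases "0 < P i x")
      case False
      then have "1 \<le> max 0 (1 - P i x / w i)"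
        using w_pos[of i] by (simp add: divide_nonpos_pos not_less)
      from quantile_ge_1[OF F1 this] False show ?thesis by simp
    qed (simp add: X_def)
    have [measurable]: "F \<in> borel_measurable borel"
      by (rule borel_measurable_mono[OF is_cdf_mono[OF cdf]])
    show ?thesis unfolding comb_pvalue_def comb_stat_def eq by measurable
  qed
  from tail_function_limit[OF g T] show ?thesis
  proof (rule Lim_transform_eventually)
    have lt1: "\<forall>\<^sub>F \<alpha>::real in at_right 0. \<alpha> < 1"
      using eventually_at_right_real[of 0 1] by (auto elim: eventually_mono)
    moreover have "\<forall>\<^sub>F \<alpha> in at_right 0. 0 < t \<alpha>"
      using t_top by (auto simp: filterlim_at_top_dense)
    ultimately show "\<forall>\<^sub>F \<alpha> in at_right 0. prob {x \<in> space M. 1 \<le> (\<Sum>i\<in>UNIV. T \<alpha> i x)} / \<alpha>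
        = prob {x \<in> space M. comb_pvalue \<gamma> F w (\<lambda>i. P i x) \<le> \<alpha>} / \<alpha>"
      using t pos
    proof eventually_elim
      case (elim \<alpha>)
      have "prob {x \<in> space M. 1 \<le> (\<Sum>i\<in>UNIV. T \<alpha> i x)}
          = prob {x \<in> space M. comb_pvalue \<gamma> F w (\<lambda>i. P i x) \<le> \<alpha>}"
      proof (rule finite_measure_eq_AE)
        show "AE x in M. x \<in> {x \<in> space M. 1 \<le> (\<Sum>i\<in>UNIV. T \<alpha> i x)}
            \<longleftrightarrow> x \<in> {x \<in> space M. comb_pvalue \<gamma> F w (\<lambda>i. P i x) \<le> \<alpha>}"
          using AE_P_pos
        proof eventually_elim
          fix x assume x: "\<forall>i. 0 < P i x"
          define S where "S = comb_stat F w (\<lambda>i. P i x)"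
          have S: "S = (\<Sum>i\<in>UNIV. X i x) / ?n" using x by (simp add: S_def comb_stat_def X_def)
          have "1 \<le> (\<Sum>i\<in>UNIV. T \<alpha> i x) \<longleftrightarrow> t \<alpha> \<le> S"
            using elim by (simp add: T_def S sum_divide_distrib[symmetric] le_divide_eq field_simps)
          also have "\<dots> \<longleftrightarrow> F (t \<alpha>) \<le> F S"
          proof
            assume a: "F (t \<alpha>) \<le> F S"
            show "t \<alpha> \<le> S"
            proof (rule ccontr)
              assume "\<not> t \<alpha> \<le> S"
              then have "max c S < t \<alpha>" using elim by simp
              then have "F (max c S) < F (t \<alpha>)"
                using smono elim by (auto simp: strict_mono_on_def)
              moreover have "F S \<le> F (max c S)" by (rule mono) simp
              ultimately show False using a by simp
            qed
          qed (rule mono)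
          also have "\<dots> \<longleftrightarrow> 1 - F S \<le> \<alpha> * ?n powr (\<gamma> - 1)" using elim by auto
          also have "\<dots> \<longleftrightarrow> ?n powr (1 - \<gamma>) * (1 - F S) \<le> \<alpha>"
          proof -
            have "?n powr (1 - \<gamma>) = inverse (?n powr (\<gamma> - 1))"
              using powr_minus[of ?n "\<gamma> - 1"] by simp
            moreover have "y \<le> \<alpha> * b \<longleftrightarrow> inverse b * y \<le> \<alpha>" if "0 < b" for y b :: real
              using that by (simp add: field_simps)
            ultimately show ?thesis using k by simp
          qed
          also have "\<dots> \<longleftrightarrow> comb_pvalue \<gamma> F w (\<lambda>i. P i x) \<le> \<alpha>"
            using elim by (simp add: comb_pvalue_def S_def min_le_iff_disj)
          finally show "x \<in> {x \<in> space M. 1 \<le> (\<Sum>i\<in>UNIV. T \<alpha> i x)}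
            \<longleftrightarrow> x \<in> {x \<in> space M. comb_pvalue \<gamma> F w (\<lambda>i. P i x) \<le> \<alpha>}" by simp
        qed
        show "{x \<in> space M. 1 \<le> (\<Sum>i\<in>UNIV. T \<alpha> i x)} \<in> sets M"
          unfolding T_def by measurable
      qed (rule comb_meas)
      then show ?case by simp
    qed
  qed
qed

section \<open>Monotonicity in the tail index and the case of equality\<close>

lemma tail_const_pnorm_Y:
  assumes g: "0 < \<gamma>"
  shows "tail_const (\<lambda>x. pnorm (1 / \<gamma>) (\<lambda>i. Y i x)) (real CARD('n) * q \<gamma>)"
  unfolding tail_const_def
proof (intro conjI ballI)
  show "(\<lambda>x. pnorm (1 / \<gamma>) (\<lambda>i. Y i x)) \<in> borel_measurable M"
    unfolding pnorm_def by measurable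
  show "0 \<le> pnorm (1 / \<gamma>) (\<lambda>i. Y i x)" for x by (rule pnorm_nonneg)
  let ?n = "real CARD('n)"
  have "filterlim (\<lambda>z::real. ?n * inverse z) (at_right 0) at_top"
    by (intro filterlim_compose[OF filterlim_mult_at_right] filterlim_inverse_at_right_top) simp
  from tendsto_mult_left[OF filterlim_compose[OF pareto_limit[OF g] this], of ?n]
  show "((\<lambda>z. z * prob {x \<in> space M. z < pnorm (1 / \<gamma>) (\<lambda>i. Y i x)}) \<longlongrightarrow> ?n * q \<gamma>) at_top"
  proof (rule Lim_transform_eventually)
    show "\<forall>\<^sub>F z in at_top. ?n * (prob {x \<in> space M. 1 < (\<Sum>i\<in>UNIV. pareto \<gamma> (?n * inverse z) i x)} / (?n * inverse z))
       = z * prob {x \<in> space M. z < pnorm (1 / \<gamma>) (\<lambda>i. Y i x)}"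
      using eventually_gt_at_top[of 0]
    proof eventually_elim
      case (elim z)
      have iff: "1 < (\<Sum>i\<in>UNIV. pareto \<gamma> (?n * inverse z) i x) \<longleftrightarrow> z < pnorm (1 / \<gamma>) (\<lambda>i. Y i x)" for x
      proof -
        have "pnorm (1 / \<gamma>) (\<lambda>i. inverse z * Y i x) = inverse z * pnorm (1 / \<gamma>) (\<lambda>i. Y i x)"
          using g elim Y_nonneg by (intro pnorm_scale) auto
        moreover have "pnorm (1 / \<gamma>) (\<lambda>i. inverse z * Y i x) = (\<Sum>i\<in>UNIV. pareto \<gamma> (?n * inverse z) i x) powr \<gamma>"
          by (simp add: pnorm_def pareto_def)
        moreover have "1 < (\<Sum>i\<in>UNIV. pareto \<gamma> (?n * inverse z) i x) powr \<gamma>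
            \<longleftrightarrow> 1 < (\<Sum>i\<in>UNIV. pareto \<gamma> (?n * inverse z) i x)" (is "1 < ?S powr \<gamma> \<longleftrightarrow> _")
        proof
          show "1 < ?S powr \<gamma>" if "1 < ?S"
            using powr_less_mono2[of \<gamma> 1 ?S] that g by simp
          show "1 < ?S" if a: "1 < ?S powr \<gamma>"
          proof (rule ccontr)
            assume "\<not> 1 < ?S"
            then have "?S powr \<gamma> \<le> 1 powr \<gamma>"
              using g by (intro powr_mono2) (auto simp: pareto_def intro!: sum_nonneg)
            with a show False by simp
          qed
        qed
        ultimately have "1 < ?S \<longleftrightarrow> 1 < inverse z * pnorm (1 / \<gamma>) (\<lambda>i. Y i x)"
          by simp
        also have "\<dots> \<longleftrightarrow> z < pnorm (1 / \<gamma>) (\<lambda>i. Y i x)"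
          using elim by (simp add: field_simps)
        finally show ?thesis .
      qed
      show ?case unfolding iff using elim by (simp add: field_simps)
    qed
  qed
qed

lemma q_mono:
  assumes g: "0 < \<gamma>2" "\<gamma>2 \<le> \<gamma>1"
  shows "q \<gamma>2 \<le> q \<gamma>1"
proof -
  have "(\<Sum>i\<in>{()}. real CARD('n) * q \<gamma>2) \<le> (\<Sum>i\<in>{()}. real CARD('n) * q \<gamma>1)"
  proof (rule tail_const_sum_mono)
    show "tail_const (\<lambda>x. pnorm (1 / \<gamma>2) (\<lambda>i. Y i x)) (real CARD('n) * q \<gamma>2)"
      "tail_const (\<lambda>x. pnorm (1 / \<gamma>1) (\<lambda>i. Y i x)) (real CARD('n) * q \<gamma>1)"
      using g by (auto intro: tail_const_pnorm_Y)
    show "(\<Sum>i\<in>{()}. pnorm (1 / \<gamma>2) (\<lambda>i. Y i x)) \<le> (\<Sum>i\<in>{()}. pnorm (1 / \<gamma>1) (\<lambda>i. Y i x))" for x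
      using g Y_nonneg by (auto intro!: pnorm_antimono simp: field_simps)
  qed auto
  then show ?thesis by simp
qed

lemma q_1: "q 1 = 1"
proof -
  let ?n = "real CARD('n)"
  have sum: "pnorm 1 (\<lambda>i. Y i x) = (\<Sum>i\<in>UNIV. Y i x)" for x
    unfolding pnorm_def using Y_nonneg by (simp add: sum_nonneg)
  have "(\<Sum>i\<in>UNIV. w i) \<le> (\<Sum>i\<in>{()}. ?n * q 1)"
  proof (rule tail_const_sum_mono[OF _ _ tail_const_Y])
    show "tail_const (\<lambda>x. pnorm (1 / 1) (\<lambda>i. Y i x)) (?n * q 1)"
      by (rule tail_const_pnorm_Y) simp
  qed (simp_all add: sum)
  moreover have "(\<Sum>i\<in>{()}. ?n * q 1) \<le> (\<Sum>i\<in>UNIV. w i)"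
  proof (rule tail_const_sum_mono[OF _ _ _ tail_const_Y])
    show "tail_const (\<lambda>x. pnorm (1 / 1) (\<lambda>i. Y i x)) (?n * q 1)"
      by (rule tail_const_pnorm_Y) simp
  qed (simp_all add: sum)
  ultimately have "?n * q 1 = ?n" by (simp add: w_sum)
  then show ?thesis by simp
qed

text \<open>Equality of \<open>q\<close> at two indices forces the tail constants of the weighted sum and the weighted
  maximum of \<open>Y\<close> to agree; the former is linear in the weights and the latter is \<open>l\<close>.\<close>

lemma l_additive_if_q_eq:
  assumes g: "0 < \<gamma>2" "\<gamma>2 < \<gamma>1" and eq: "q \<gamma>1 = q \<gamma>2" and v: "\<And>i. 0 \<le> v i"
  shows "l v = (\<Sum>i\<in>UNIV. v i)"
proof (rule antisym)
  show "l v \<le> (\<Sum>i\<in>UNIV. v i)" by (rule l_le_sum[OF v])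
  let ?n = "real CARD('n)"
  \<comment> \<open>With these weights, \<open>c i * Y i\<close> has tail constant \<open>v i\<close>.\<close>
  define c where "c i = v i / w i" for i
  have c: "0 \<le> c i" for i using v w_pos[of i] by (simp add: c_def)
  have cw: "c i * w i = v i" for i using w_pos[of i] by (simp add: c_def)
  have p: "0 < 1 / \<gamma>1" "1 / \<gamma>1 < 1 / \<gamma>2" using g by (auto simp: field_simps)
  show "(\<Sum>i\<in>UNIV. v i) \<le> l v"
  proof (rule field_le_epsilon)
    fix e' :: real assume e': "0 < e'"
    define e where "e = e' / ?n"
    have e: "0 < e" using e' by (simp add: e_def)
    obtain C where C': "0 \<le> C \<and> (\<forall>y. (\<forall>i. 0 \<le> y i) \<longrightarrow>
        (\<Sum>i\<in>UNIV. c i * y i) + C * pnorm (1 / \<gamma>2) y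
        \<le> wmax c y + e * (\<Sum>i\<in>UNIV. y i) + C * pnorm (1 / \<gamma>1) y)"
      using weighted_sum_minus_max_dominated[OF p c e] ..
    note C = C'[THEN conjunct1] C'[THEN conjunct2, rule_format]
    \<comment> \<open>The summands on both sides are indexed by option types.\<close>
    define Z where "Z = case_option (\<lambda>x. C * pnorm (1 / \<gamma>2) (\<lambda>i. Y i x)) (\<lambda>i x. c i * Y i x)"
    define kZ where "kZ = case_option (C * (?n * q \<gamma>2)) (\<lambda>i. c i * w i)"
    define W where "W = case_option (\<lambda>x. wmax c (\<lambda>i. Y i x))
      (case_option (\<lambda>x. C * pnorm (1 / \<gamma>1) (\<lambda>i. Y i x)) (\<lambda>i x. e * Y i x))"
    define kW where "kW = case_option (l (\<lambda>i. c i * w i))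
      (case_option (C * (?n * q \<gamma>1)) (\<lambda>i. e * w i))"
    have "(\<Sum>j\<in>UNIV. kZ j) \<le> (\<Sum>j\<in>UNIV. kW j)"
    proof (rule tail_const_sum_mono)
      show "tail_const (Z j) (kZ j)" for j
        using g C(1) c by (cases j)
          (auto simp: Z_def kZ_def intro!: tail_const_scale tail_const_pnorm_Y tail_const_Y)
      show "tail_const (W j) (kW j)" for j
        unfolding W_def kW_def using g C(1) c e
        by (auto split: option.split intro!: tail_const_scale tail_const_pnorm_Y tail_const_Y tail_const_wmax_Y)
      show "(\<Sum>j\<in>UNIV. Z j x) \<le> (\<Sum>j\<in>UNIV. W j x)" for x
        using C(2)[of "\<lambda>i. Y i x"] Y_nonneg
        by (simp add: sum_UNIV_option Z_def W_def sum_distrib_left)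
    qed auto
    then have "(\<Sum>i\<in>UNIV. v i) \<le> l v + e * ?n"
      by (simp add: sum_UNIV_option kZ_def kW_def eq cw sum_distrib_left[symmetric] w_sum)
    then show "(\<Sum>i\<in>UNIV. v i) \<le> l v + e'" by (simp add: e_def)
  qed
qed

lemma q_eq_1_if_l_additive:
  assumes add: "\<And>v. (\<And>i. 0 \<le> v i) \<Longrightarrow> l v = (\<Sum>i\<in>UNIV. v i)" and g: "0 < \<gamma>"
  shows "q \<gamma> = 1"
proof -
  let ?n = "real CARD('n)"
  have lw: "l (\<lambda>i. 1 * w i) = ?n" using add[of w] w_pos by (simp add: less_imp_le w_sum)
  have max: "tail_const (\<lambda>x. wmax (\<lambda>_. 1) (\<lambda>i. Y i x)) ?n"
    using tail_const_wmax_Y[of "\<lambda>_. 1"] unfolding lw by simp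
  have "(\<Sum>i\<in>{()}. ?n) \<le> (\<Sum>i\<in>{()}. ?n * q \<gamma>)"
    by (rule tail_const_sum_mono[OF _ _ max tail_const_pnorm_Y])
       (use g Y_nonneg in \<open>auto intro!: wmax_le_pnorm\<close>)
  then have ge: "1 \<le> q \<gamma>" by simp
  have "?n * q \<gamma> \<le> ?n"
  proof (rule field_le_epsilon)
    fix e' :: real assume e': "0 < e'"
    define e where "e = e' / ?n"
    have e: "0 < e" using e' by (simp add: e_def)
    have p: "0 < 1 / \<gamma>" using g by simp
    obtain C where C': "0 \<le> C \<and> (\<forall>y :: 'n \<Rightarrow> real. (\<forall>i. 0 \<le> y i) \<longrightarrow>
        pnorm (1 / \<gamma>) y + C * wmax (\<lambda>_. 1) y
        \<le> wmax (\<lambda>_. 1) y + (e + C) * (\<Sum>i\<in>UNIV. y i))"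
      using pnorm_minus_max_dominated[OF p e] ..
    note C = C'[THEN conjunct1] C'[THEN conjunct2, rule_format]
    define Z where "Z = case_bool (\<lambda>x. pnorm (1 / \<gamma>) (\<lambda>i. Y i x)) (\<lambda>x. C * wmax (\<lambda>_. 1) (\<lambda>i. Y i x))"
    define kZ where "kZ = case_bool (?n * q \<gamma>) (C * ?n)"
    define W where "W = case_option (\<lambda>x. wmax (\<lambda>_. 1) (\<lambda>i. Y i x)) (\<lambda>i x. (e + C) * Y i x)"
    define kW where "kW = case_option ?n (\<lambda>i. (e + C) * w i)"
    have "(\<Sum>j\<in>UNIV. kZ j) \<le> (\<Sum>j\<in>UNIV. kW j)"
    proof (rule tail_const_sum_mono)
      show "tail_const (Z j) (kZ j)" for j
        using g C(1) max by (cases j)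
          (auto simp: Z_def kZ_def intro!: tail_const_scale tail_const_pnorm_Y)
      show "tail_const (W j) (kW j)" for j
        unfolding W_def kW_def using C(1) e max
        by (auto split: option.split intro!: tail_const_scale tail_const_Y)
      show "(\<Sum>j\<in>UNIV. Z j x) \<le> (\<Sum>j\<in>UNIV. W j x)" for x
        using C(2)[of "\<lambda>i. Y i x"] Y_nonneg
        by (simp add: sum_UNIV_option Z_def W_def sum_distrib_left UNIV_bool add.commute)
    qed auto
    then have "?n * q \<gamma> + C * ?n \<le> ?n + (e + C) * ?n"
      by (simp add: sum_UNIV_option kZ_def kW_def sum_distrib_left[symmetric] w_sum UNIV_bool add.commute)
    then have "?n * q \<gamma> \<le> ?n + e * ?n" by (simp add: algebra_simps)
    then show "?n * q \<gamma> \<le> ?n + e'" by (simp add: e_def)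
  qed
  then have "q \<gamma> \<le> 1" by simp
  with ge show ?thesis by simp
qed

end

section \<open>Copulas and their margins\<close>

text \<open>The uniform distribution on the unit interval.\<close>

definition U01 :: "real measure" where "U01 = uniform_measure lborel {0..1}"

lemma prob_space_U01: "prob_space U01"
  unfolding U01_def by (rule prob_space_uniform_measure) auto

lemma sets_U01 [simp, measurable_cong]: "sets U01 = sets borel" by (simp add: U01_def)

lemma emeasure_U01_atMost: "emeasure U01 {..u} = ennreal (clamp01 u)"
proof -
  have "{0..1} \<inter> {..u} = {0..min 1 u}" by auto
  then show ?thesis
    by (simp add: U01_def clamp01_def emeasure_lborel_Icc_eq divide_ennreal_def max_def)
qed

lemma is_copula_prod: "is_copula (\<lambda>u :: 'n::finite \<Rightarrow> real. \<Prod>i\<in>UNIV. u i)"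
proof -
  interpret U: prob_space U01 by (rule prob_space_U01)
  interpret product_prob_space "\<lambda>_. U01" "UNIV :: 'n set" ..
  let ?N = "\<Pi>\<^sub>M i\<in>(UNIV :: 'n set). U01"
  have "prob_space ?N" by (rule prob_space_PiM) (rule prob_space_U01)
  moreover have "sets ?N = sets (\<Pi>\<^sub>M i\<in>(UNIV :: 'n set). borel)"
    by (rule sets_PiM_cong) auto
  moreover have "distr ?N borel (\<lambda>x. x i) = uniform_measure lborel {0..1}" for i
  proof -
    have "distr ?N borel (\<lambda>x. x i) = distr ?N U01 (\<lambda>x. x i)"
      by (rule distr_cong) auto
    also have "\<dots> = U01"
      by (rule distr_PiM_component) (auto intro: prob_space_U01)
    finally show ?thesis by (simp add: U01_def)
  qed
  moreover have "(\<Prod>i\<in>UNIV. u i) = joint_cdf ?N (\<lambda>i x. x i) u" if u: "u \<in> unit_cube" for u :: "'n \<Rightarrow> real"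
  proof -
    have "{x \<in> space ?N. \<forall>i. x i \<le> u i} = PiE UNIV (\<lambda>i. {..u i})"
      by (auto simp: space_PiM U01_def PiE_def)
    then have "joint_cdf ?N (\<lambda>i x. x i) u = measure ?N (PiE UNIV (\<lambda>i. {..u i}))"
      by (simp add: joint_cdf_def)
    also have "emeasure ?N (PiE UNIV (\<lambda>i. {..u i})) = (\<Prod>i\<in>UNIV. emeasure U01 {..u i})"
      by (rule emeasure_PiM) auto
    then have "measure ?N (PiE UNIV (\<lambda>i. {..u i})) = enn2real (\<Prod>i\<in>UNIV. ennreal (clamp01 (u i)))"
      by (simp add: measure_def emeasure_U01_atMost)
    also have "\<dots> = (\<Prod>i\<in>UNIV. clamp01 (u i))"
    proof -
      have "0 \<le> clamp01 (u i)" for i by (simp add: clamp01_def)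
      then show ?thesis by (simp add: prod_ennreal prod_nonneg)
    qed
    also have "\<dots> = (\<Prod>i\<in>UNIV. u i)"
      using u by (intro prod.cong) (auto simp: clamp01_def unit_cube_def)
    finally show ?thesis by simp
  qed
  ultimately show ?thesis unfolding is_copula_def by blast
qed

lemma copula_univariate_margin:
  assumes C: "is_copula C" and v: "0 \<le> v" "v \<le> 1"
  shows "C (\<lambda>j. if j = i then v else 1) = v"
proof -
  obtain N where N: "prob_space N" "sets N = sets (\<Pi>\<^sub>M i\<in>(UNIV :: 'a set). borel)"
    "\<And>i. distr N borel (\<lambda>x. x i) = U01" "\<And>u. u \<in> unit_cube \<Longrightarrow> C u = joint_cdf N (\<lambda>i x. x i) u"
    using C by (auto simp: is_copula_def U01_def)
  interpret N: prob_space N by fact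
  have [measurable]: "(\<lambda>x. x j) \<in> borel_measurable N" for j
    by (subst measurable_cong_sets[OF N(2) refl]) measurable
  have marg: "N.prob {x \<in> space N. x j \<le> u} = clamp01 u" for j u
  proof -
    have "N.prob {x \<in> space N. x j \<le> u} = measure (distr N borel (\<lambda>x. x j)) {..u}"
      by (subst measure_distr) (auto intro!: arg_cong[where f = N.prob])
    also have "\<dots> = clamp01 u"
      unfolding N(3) measure_def emeasure_U01_atMost by (rule enn2real_ennreal) (simp add: clamp01_def)
    finally show ?thesis .
  qed
  have "AE x in N. \<forall>j. x j \<le> 1"
  proof -
    have "AE x in N. x j \<le> 1" for j
      using N.prob_Collect_eq_1[of "\<lambda>x. x j \<le> 1"] marg[of j 1] by (simp add: clamp01_def)
    then show ?thesis by (simp add: AE_all_countable)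
  qed
  then have "N.prob {x \<in> space N. \<forall>j. x j \<le> (if j = i then v else 1)} = N.prob {x \<in> space N. x i \<le> v}"
    by (intro N.finite_measure_eq_AE) (auto elim!: eventually_mono split: if_splits)
  moreover have "(\<lambda>j. if j = i then v else 1) \<in> unit_cube"
    using v by (auto simp: unit_cube_def)
  ultimately show ?thesis using v by (simp add: N(4) joint_cdf_def marg clamp01_def)
qed

lemma copula_marginal_prob:
  fixes P :: "'n::finite \<Rightarrow> 'a \<Rightarrow> real"
  assumes M: "prob_space M" and [measurable]: "\<And>i. P i \<in> borel_measurable M"
    and C: "is_copula (joint_cdf M (\<lambda>i x. 1 - P i x))"
  shows "measure M {x \<in> space M. P i x < v} = clamp01 v"
proof -
  interpret prob_space M by fact
  have "prob {x \<in> space M. \<forall>j. 1 - P j x \<le> (if j = i then 1 else 1)} = 1"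
    using copula_univariate_margin[OF C, of 1 i] by (simp add: joint_cdf_def)
  then have ae: "AE x in M. \<forall>j. 1 - P j x \<le> 1"
    by (subst (asm) prob_Collect_eq_1) simp_all
  have upper: "prob {x \<in> space M. 1 - P i x \<le> u} = u" if u: "0 \<le> u" "u \<le> 1" for u
  proof -
    have "prob {x \<in> space M. 1 - P i x \<le> u} = prob {x \<in> space M. \<forall>j. 1 - P j x \<le> (if j = i then u else 1)}"
      using ae by (intro finite_measure_eq_AE) (auto elim!: eventually_mono split: if_splits)
    also have "\<dots> = u" using copula_univariate_margin[OF C u] by (simp add: joint_cdf_def)
    finally show ?thesis .
  qed
  have compl: "prob {x \<in> space M. P i x < v} = 1 - prob {x \<in> space M. 1 - P i x \<le> 1 - v}" for v
  proof -
    have "{x \<in> space M. P i x < v} = space M - {x \<in> space M. 1 - P i x \<le> 1 - v}" by auto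
    then show ?thesis by (simp only:) (rule prob_compl, measurable)
  qed
  have mid: "prob {x \<in> space M. P i x < v} = v" if "0 \<le> v" "v \<le> 1" for v
    unfolding compl[of v] using upper[of "1 - v"] that by simp
  consider "v < 0" | "0 \<le> v" "v \<le> 1" | "1 < v" by linarith
  then show ?thesis
  proof cases
    case 1
    have "prob {x \<in> space M. P i x < v} \<le> prob {x \<in> space M. P i x < 0}"
      using 1 by (intro finite_measure_mono) auto
    then have "prob {x \<in> space M. P i x < v} = 0" using mid[of 0] by (simp add: measure_le_0_iff)
    with 1 show ?thesis by (simp add: clamp01_def)
  next
    case 2
    then show ?thesis using mid by (simp add: clamp01_def)
  next
    case 3
    have "prob {x \<in> space M. P i x < 1} \<le> prob {x \<in> space M. P i x < v}"
      using 3 by (intro finite_measure_mono) auto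
    then have "prob {x \<in> space M. P i x < v} = 1" using mid[of 1] by (simp add: measure_ge_1_iff)
    with 3 show ?thesis by (simp add: clamp01_def)
  qed
qed

section \<open>Asymptotic independence\<close>

lemma powr_inverse_limit:
  fixes d :: "real \<Rightarrow> real"
  assumes d: "((\<lambda>s. d s / s) \<longlongrightarrow> k) (at_right 0)"
  shows "((\<lambda>s. (1 - d s) powr (1 / s)) \<longlongrightarrow> exp (- k)) (at_right 0)"
proof -
  have pos: "\<forall>\<^sub>F s::real in at_right 0. 0 < s" by (rule eventually_at_right_less)
  have "((\<lambda>s. d s / s * s) \<longlongrightarrow> k * 0) (at_right 0)"
    by (intro tendsto_mult d tendsto_ident_at)
  then have "((\<lambda>s. d s / s * s) \<longlongrightarrow> 0) (at_right 0)" by simp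
  then have d0: "(d \<longlongrightarrow> 0) (at_right 0)"
    by (rule Lim_transform_eventually[OF _ eventually_mono[OF pos]]) simp
  have small: "\<forall>\<^sub>F s in at_right 0. \<bar>d s\<bar> < 1 / 2"
    using order_tendstoD(2)[OF tendsto_rabs_zero[OF d0], of "1/2"] by simp
  have "((\<lambda>s. ln (1 - d s) / s + d s / s) \<longlongrightarrow> 0) (at_right 0)"
  proof (rule Lim_null_comparison)
    show "((\<lambda>s. 2 * (\<bar>d s\<bar> * \<bar>d s / s\<bar>)) \<longlongrightarrow> 0) (at_right 0)"
      using tendsto_mult_left[OF tendsto_mult[OF tendsto_rabs_zero[OF d0] tendsto_rabs[OF d]], of 2] by simp
    show "\<forall>\<^sub>F s in at_right 0. norm (ln (1 - d s) / s + d s / s) \<le> 2 * (\<bar>d s\<bar> * \<bar>d s / s\<bar>)"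
      using pos small
    proof eventually_elim
      case (elim s)
      have "\<bar>ln (1 + (- d s)) - (- d s)\<bar> \<le> 2 * (- d s)\<^sup>2"
        using elim by (intro abs_ln_one_plus_x_minus_x_bound) simp
      then have "\<bar>ln (1 - d s) + d s\<bar> / s \<le> 2 * (\<bar>d s\<bar> * \<bar>d s\<bar>) / s"
        using elim by (intro divide_right_mono) (simp_all add: power2_eq_square)
      moreover have "norm (ln (1 - d s) / s + d s / s) = \<bar>ln (1 - d s) + d s\<bar> / s"
        using elim by (simp add: add_divide_distrib[symmetric])
      moreover have "2 * (\<bar>d s\<bar> * \<bar>d s / s\<bar>) = 2 * (\<bar>d s\<bar> * \<bar>d s\<bar>) / s"
        using elim by simp
      ultimately show ?case by argo
    qed
  qed
  from tendsto_diff[OF this d] have "((\<lambda>s. ln (1 - d s) / s) \<longlongrightarrow> - k) (at_right 0)" by simp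
  from tendsto_exp[OF this] show ?thesis
  proof (rule Lim_transform_eventually)
    show "\<forall>\<^sub>F s in at_right 0. exp (ln (1 - d s) / s) = (1 - d s) powr (1 / s)"
      using small by eventually_elim (simp add: powr_def)
  qed
qed

context mrv_pvalues
begin

lemma joint_cdf_eq: "joint_cdf M (\<lambda>i x. 1 - P i x) u = 1 - D (\<lambda>i. 1 - u i)"
proof -
  have iff: "1 - P i x \<le> u i \<longleftrightarrow> \<not> P i x < 1 - u i" for i x by auto
  have "{x \<in> space M. \<forall>i. 1 - P i x \<le> u i} = space M - {x \<in> space M. \<exists>i. P i x < 1 - u i}"
    unfolding iff by blast
  then show ?thesis
    unfolding joint_cdf_def D_def by (simp only:) (rule prob_compl, measurable)
qed

lemma D_cong_clamp: "(\<And>i. clamp01 (u i) = clamp01 (v i)) \<Longrightarrow> D u = D v"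
  using D_diff_le[of u v] D_diff_le[of v u] by simp

lemma cdf_one_minus_P: "cdf (distr M borel (\<lambda>x. 1 - P i x)) v = clamp01 v"
proof -
  have "cdf (distr M borel (\<lambda>x. 1 - P i x)) v = prob {x \<in> space M. 1 - P i x \<le> v}"
    unfolding cdf_def by (subst measure_distr) (auto intro!: arg_cong[where f = prob])
  also have "{x \<in> space M. 1 - P i x \<le> v} = space M - {x \<in> space M. P i x < 1 - v}" by auto
  also have "prob \<dots> = 1 - clamp01 (1 - v)" by (subst prob_compl) (auto simp: uniform)
  also have "\<dots> = clamp01 v" unfolding clamp01_def by linarith
  finally show ?thesis .
qed

lemma joint_cdf_clamp:
  "joint_cdf M (\<lambda>i x. 1 - P i x) u = joint_cdf M (\<lambda>i x. 1 - P i x) (\<lambda>i. clamp01 (u i))"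
proof -
  have "clamp01 (1 - u i) = clamp01 (1 - clamp01 (u i))" for i unfolding clamp01_def by linarith
  then have "D (\<lambda>i. 1 - u i) = D (\<lambda>i. 1 - clamp01 (u i))" by (rule D_cong_clamp)
  then show ?thesis unfolding joint_cdf_eq by simp
qed

lemma copula_power_limit:
  assumes u: "\<And>i. 0 < u i \<and> u i \<le> 1"
  shows "((\<lambda>t. joint_cdf M (\<lambda>i x. 1 - P i x) (\<lambda>i. u i powr (1 / t)) powr t)
    \<longlongrightarrow> exp (- l (\<lambda>i. - ln (u i)))) at_top"
proof -
  have "((\<lambda>s. D (\<lambda>i. 1 - u i powr s) / s) \<longlongrightarrow> l (\<lambda>i. - ln (u i))) (at_right 0)"
  proof (rule D_limit)
    show "0 \<le> - ln (u i)" for i using u[of i] by simp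
    show "((\<lambda>s. (1 - u i powr s) / s) \<longlongrightarrow> - ln (u i)) (at_right 0)" for i
      using u[of i] by real_asymp
  qed
  from powr_inverse_limit[OF this]
  have "((\<lambda>t. (1 - D (\<lambda>i. 1 - u i powr inverse t)) powr (1 / inverse t))
    \<longlongrightarrow> exp (- l (\<lambda>i. - ln (u i)))) at_top"
    unfolding filterlim_at_right_to_top .
  then show ?thesis by (simp add: joint_cdf_eq divide_inverse)
qed

lemma copula_power_zero:
  assumes u: "u i = 0"
  shows "joint_cdf M (\<lambda>i x. 1 - P i x) (\<lambda>i. u i powr (1 / t)) = 0"
proof -
  have "prob {x \<in> space M. P i x < 1} \<le> D (\<lambda>i. 1 - u i powr (1 / t))"
    unfolding D_def using u by (intro finite_measure_mono) (auto intro!: exI[of _ i])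
  then have "1 \<le> D (\<lambda>i. 1 - u i powr (1 / t))" by (simp add: uniform clamp01_def)
  moreover have "D (\<lambda>i. 1 - u i powr (1 / t)) \<le> 1" by (simp add: D_def)
  ultimately show ?thesis by (simp add: joint_cdf_eq)
qed

text \<open>The limiting copula at \<open>u\<close> is \<open>exp (- l (- ln u))\<close> if all coordinates of \<open>u\<close> are positive, which is
  the independence copula exactly if \<open>l\<close> is the coordinate sum. The copula of \<open>1 - P\<close> is unique on
  the unit cube, as its values are those of the joint distribution function.\<close>

lemma asymptotically_independent_iff:
  assumes mrv: "mrv_copula (joint_cdf M (\<lambda>i x. 1 - P i x))"
  shows "asymptotically_independent M (\<lambda>i x. 1 - P i x) \<longleftrightarrow>
    (\<forall>v. (\<forall>i. 0 \<le> v i) \<longrightarrow> l v = (\<Sum>i\<in>UNIV. v i))"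
proof
  let ?C = "joint_cdf M (\<lambda>i x. 1 - P i x)"
  assume "asymptotically_independent M (\<lambda>i x. 1 - P i x)"
  then obtain C where C: "copula_of M (\<lambda>i x. 1 - P i x) C"
    "limiting_copula C (\<lambda>u. \<Prod>i\<in>UNIV. u i)"
    by (auto simp: asymptotically_independent_def)
  show "\<forall>v. (\<forall>i. 0 \<le> v i) \<longrightarrow> l v = (\<Sum>i\<in>UNIV. v i)"
  proof (intro allI impI)
    fix v :: "'n \<Rightarrow> real" assume v: "\<forall>i. 0 \<le> v i"
    define u where "u i = exp (- v i)" for i
    have u: "0 < u i \<and> u i \<le> 1" for i using v by (simp add: u_def)
    have "((\<lambda>t. C (\<lambda>i. u i powr (1 / t)) powr t) \<longlongrightarrow> (\<Prod>i\<in>UNIV. u i)) at_top"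
      using C(2) u by (auto simp: limiting_copula_def unit_cube_def less_imp_le)
    moreover have "\<forall>\<^sub>F t in at_top. C (\<lambda>i. u i powr (1 / t)) powr t = ?C (\<lambda>i. u i powr (1 / t)) powr t"
      using eventually_gt_at_top[of 0]
    proof eventually_elim
      case (elim t)
      have "clamp01 (u i powr (1 / t)) = u i powr (1 / t)" for i
        using u[of i] elim powr_le1[of "1 / t" "u i"] by (simp add: clamp01_def)
      then have "?C (\<lambda>i. u i powr (1 / t)) = C (\<lambda>i. u i powr (1 / t))"
        using C(1) by (simp add: copula_of_def cdf_one_minus_P)
      then show ?case by simp
    qed
    ultimately have "((\<lambda>t. ?C (\<lambda>i. u i powr (1 / t)) powr t) \<longlongrightarrow> (\<Prod>i\<in>UNIV. u i)) at_top"
      by (rule Lim_transform_eventually)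
    from tendsto_unique[OF _ this copula_power_limit[of u, OF u]]
    have "(\<Prod>i\<in>UNIV. u i) = exp (- l (\<lambda>i. - ln (u i)))" by simp
    then have "exp (- (\<Sum>i\<in>UNIV. v i)) = exp (- l v)"
      by (simp add: u_def exp_sum[symmetric] sum_negf)
    then show "l v = (\<Sum>i\<in>UNIV. v i)" by simp
  qed
next
  let ?C = "joint_cdf M (\<lambda>i x. 1 - P i x)"
  assume add: "\<forall>v. (\<forall>i. 0 \<le> v i) \<longrightarrow> l v = (\<Sum>i\<in>UNIV. v i)"
  have "limiting_copula ?C (\<lambda>u. \<Prod>i\<in>UNIV. u i)"
    unfolding limiting_copula_def
  proof (intro conjI ballI is_copula_prod)
    fix u :: "'n \<Rightarrow> real" assume u: "u \<in> unit_cube"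
    show "((\<lambda>t. ?C (\<lambda>i. u i powr (1 / t)) powr t) \<longlongrightarrow> (\<Prod>i\<in>UNIV. u i)) at_top"
    proof (cases "\<exists>i. u i = 0")
      case True
      then obtain i where i: "u i = 0" by blast
      then have "(\<Prod>i\<in>UNIV. u i) = 0" by (intro prod_zero) auto
      with copula_power_zero[of u i, OF i] show ?thesis by (simp only:) simp
    next
      case False
      then have u': "0 < u i \<and> u i \<le> 1" for i
        using u by (auto simp: unit_cube_def less_le)
      have "exp (- l (\<lambda>i. - ln (u i))) = exp (\<Sum>i\<in>UNIV. ln (u i))"
        using add u' by (simp add: sum_negf)
      also have "\<dots> = (\<Prod>i\<in>UNIV. u i)" using u' by (simp add: exp_sum)
      finally show ?thesis using copula_power_limit[of u, OF u'] by simp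
    qed
  qed
  moreover have "copula_of M (\<lambda>i x. 1 - P i x) ?C"
    using mrv joint_cdf_clamp by (auto simp: copula_of_def mrv_copula_def cdf_one_minus_P)
  moreover have "continuous_on UNIV (cdf (distr M borel (\<lambda>x. 1 - P i x)))" for i
    unfolding cdf_one_minus_P[abs_def] clamp01_def by (intro continuous_intros)
  ultimately show "asymptotically_independent M (\<lambda>i x. 1 - P i x)"
    using mrv by (auto simp: asymptotically_independent_def)
qed

end

section \<open>The scaled type-I error of the combination test\<close>

theorem theorem4p1:
  fixes M :: "'a measure" and P :: "'n::finite \<Rightarrow> 'a \<Rightarrow> real" and w :: "'n \<Rightarrow> real"
  assumes "prob_space M"
    and "\<And>i. P i \<in> borel_measurable M"
    and "\<And>i. w i > 0"
    and "(\<Sum>i\<in>UNIV. w i) = real CARD('n)"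
    and "mrv_copula (joint_cdf M (\<lambda>i x. 1 - P i x))"
  shows "\<exists>q :: real \<Rightarrow> real.
    (\<forall>\<gamma>>0. \<forall>F\<in>RV_star \<gamma>.
       ((\<lambda>\<alpha>. measure M {x \<in> space M. comb_pvalue \<gamma> F w (\<lambda>i. P i x) \<le> \<alpha>} / \<alpha>)
          \<longlongrightarrow> q \<gamma>) (at_right 0)) \<and>
    (\<forall>\<gamma>1 \<gamma>2. \<gamma>1 > \<gamma>2 \<and> \<gamma>2 > 0 \<longrightarrow>
       q \<gamma>1 \<ge> q \<gamma>2 \<and>
       (q \<gamma>1 = q \<gamma>2 \<longleftrightarrow> asymptotically_independent M (\<lambda>i x. 1 - P i x))) \<and>
    q 1 = 1 \<and>
    (\<forall>\<gamma>. 0 < \<gamma> \<and> \<gamma> \<le> 1 \<longrightarrow> q \<gamma> \<le> 1)"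
proof -
  have M: "prob_space M" and P: "\<And>i. P i \<in> borel_measurable M" and w: "\<And>i. 0 < w i"
    and wsum: "(\<Sum>i\<in>UNIV. w i) = real CARD('n)"
    and mrv: "mrv_copula (joint_cdf M (\<lambda>i x. 1 - P i x))"
    by fact+
  obtain l where C: "is_copula (joint_cdf M (\<lambda>i x. 1 - P i x))"
    and l: "\<And>v. (\<forall>i. 0 \<le> v i) \<Longrightarrow>
      ((\<lambda>s. copula_tail (joint_cdf M (\<lambda>i x. 1 - P i x)) (\<lambda>i. s * v i) / s) \<longlongrightarrow> l v) (at_right 0)"
    using mrv by (auto simp: mrv_copula_def)
  have tail: "copula_tail (joint_cdf M (\<lambda>i x. 1 - P i x)) v = measure M {x \<in> space M. \<exists>i. P i x < v i}" for v
  proof -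
    interpret prob_space M by fact
    have iff: "P i x < v i \<longleftrightarrow> \<not> 1 - P i x \<le> 1 - v i" for i x by auto
    have "{x \<in> space M. \<exists>i. P i x < v i} = space M - {x \<in> space M. \<forall>i. 1 - P i x \<le> 1 - v i}"
      unfolding iff by blast
    then show ?thesis
      using P by (simp add: copula_tail_def joint_cdf_def prob_compl)
  qed
  interpret mrv_pvalues M P w l
  proof (intro mrv_pvalues.intro mrv_pvalues_axioms.intro)
    show "measure M {x \<in> space M. P i x < v} = clamp01 v" for i v
      by (rule copula_marginal_prob[OF M P C])
    show "((\<lambda>s. measure M {x \<in> space M. \<exists>i. P i x < s * v i} / s) \<longlongrightarrow> l v) (at_right 0)"
      if "\<And>i. 0 \<le> v i" for v
      using l[of v] that by (simp add: tail)
  qed (fact M P w wsum)+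
  show ?thesis
  proof (intro exI[of _ q] conjI allI impI ballI)
    show "((\<lambda>\<alpha>. prob {x \<in> space M. comb_pvalue \<gamma> F w (\<lambda>i. P i x) \<le> \<alpha>} / \<alpha>) \<longlongrightarrow> q \<gamma>) (at_right 0)"
      if "0 < \<gamma>" "F \<in> RV_star \<gamma>" for \<gamma> F
      using that by (rule comb_pvalue_limit)
    show "q 1 = 1" by (rule q_1)
    show "q \<gamma> \<le> 1" if "0 < \<gamma> \<and> \<gamma> \<le> 1" for \<gamma>
      using q_mono[of \<gamma> 1] that by (simp add: q_1)
  next
    fix \<gamma>1 \<gamma>2 :: real assume g: "\<gamma>2 < \<gamma>1 \<and> 0 < \<gamma>2"
    show "q \<gamma>2 \<le> q \<gamma>1" using g by (intro q_mono) auto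
    show "q \<gamma>1 = q \<gamma>2 \<longleftrightarrow> asymptotically_independent M (\<lambda>i x. 1 - P i x)"
      unfolding asymptotically_independent_iff[OF mrv]
    proof
      assume "q \<gamma>1 = q \<gamma>2"
      then show "\<forall>v. (\<forall>i. 0 \<le> v i) \<longrightarrow> l v = (\<Sum>i\<in>UNIV. v i)"
        using l_additive_if_q_eq[of \<gamma>2 \<gamma>1] g by simp
    next
      assume "\<forall>v. (\<forall>i. 0 \<le> v i) \<longrightarrow> l v = (\<Sum>i\<in>UNIV. v i)"
      then have "q \<gamma> = 1" if "0 < \<gamma>" for \<gamma>
        using q_eq_1_if_l_additive that by simp
      then show "q \<gamma>1 = q \<gamma>2" using g by simp
    qed
  qed
qed

end
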